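(* Let $n\ge2$. Let $\iota:\mathrm{TL}_n\to\mathrm{ATL}_n$ be the ring homomorphism which sends $z$ to $z_0$, and $E_i$ to $F_i$ for all $i\in\{1,\dots,n-1\}$. Then $\iota$ is injective.
   Context: The Temperley--Lieb algebra $\mathrm{TL}_n$ is the algebra over $R_0^f=\mathbb{Z}[z]$ presented by generators $E_1,\dots,E_{n-1}$ and relations $E_i^2=zE_i$ for $1\le i\le n-1$, $E_iE_j=E_jE_i$ for $|i-j|\ge2$, $E_iE_jE_i=E_i$ for $|i-j|=1$. Let $R_0^a=\mathbb{Z}[z_0,z_1,z_2,\dots]$. For $n\ge1$ let $V_n=\{0,1\}\times\{1,\dots,n\}$, ordered by $(0,1)<(0,2)<\cdots<(0,n)<(1,n)<\cdots<(1,2)<(1,1)$. A flat virtual $n$-tangle is a partition of $V_n$ into pairs; $\mathcal{E}_n$ is the set of these. An arrow flat $n$-tangle is a pair $F=(E,f)$ with $E\in\mathcal{E}_n$ and $f:E\to\mathbb{Z}$ such that, for $\alpha=\{(a,b),(c,d)\}\in E$, $f(\alpha)$ is odd if $a=c$ and even if $a\ne c$. $\mathcal{F}_n$ is the set of arrow flat $n$-tangles, and $\mathrm{ATL}_n$ is the free $R_0^a$-module with basis $\mathcal{F}_n$, with the multiplication defined as follows. Let $E,E'\in\mathcal{E}_n$. An arc of length $\ell$ in $E\sqcup E'$ is an $\ell$-tuple $\hat\alpha=(\alpha_1,\dots,\alpha_\ell)$ of elements of $E\sqcup E'$, $\alpha_i=\{(a_i,b_{i-1}),(c_i,b_i)\}$,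 such that: (a) if $\alpha_i\in E$ and $i<\ell$, then $c_i=1$, $\alpha_{i+1}\in E'$ and $a_{i+1}=0$; (b) if $\alpha_i\in E'$ and $i<\ell$, then $c_i=0$, $\alpha_{i+1}\in E$ and $a_{i+1}=1$; (c) $a_1=0$ if $\alpha_1\in E$, $a_1=1$ if $\alpha_1\in E'$, $c_\ell=0$ if $\alpha_\ell\in E$, $c_\ell=1$ if $\alpha_\ell\in E'$, and $(a_1,b_0)<(c_\ell,b_\ell)$. Its boundary is $\partial\hat\alpha=\{(a_1,b_0),(c_\ell,b_\ell)\}$. There are $n$ arcs and their boundaries form a flat virtual $n$-tangle $E*E'$. A cycle of length $2p\ge2$ in $E\sqcup E'$ is a $2p$-tuple $\hat\gamma=(\gamma_1,\dots,\gamma_{2p})$, $\gamma_i=\{(a_i,b_{i-1}),(c_i,b_i)\}$, such that $\gamma_i\in E$ and $a_i=c_i=1$ for $i$ odd, $\gamma_i\in E'$ and $a_i=c_i=0$ for $i$ even, and $b_0=b_{2p}<b_i$ for $1\le i\le 2p-1$. The parity of $\alpha=\{(a,b),(c,d)\}$ is $\varpi(\alpha)=-1$ if $a=c$ and $\varpi(\alpha)=1$ if $a\ne c$. For an arc or cycle $(\alpha_1,\dots,\alpha_\ell)$ with $\alpha_i=\{(a_i,b_{i-1}),(c_i,b_i)\}$, the cumulated parity is $\varpi^c(\alpha_i)=\prod_{j=1}^{i-1}\varpi(\alpha_j)$ if $(a_i,b_{i-1})<(c_i,b_i)$, and $\varpi^c(\alpha_i)=\prod_{j=1}^{i}\varpi(\alpha_j)$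 if $(c_i,b_i)<(a_i,b_{i-1})$. Let $F=(E,f)$, $F'=(E',f')\in\mathcal{F}_n$, and let $f^*$ equal $f$ on $E$ and $f'$ on $E'$. For an arc $\hat\alpha$ of $E\sqcup E'$ put $g(\partial\hat\alpha)=\sum_{i=1}^\ell\varpi^c(\alpha_i)f^*(\alpha_i)$, and set $F*F'=(E*E',g)\in\mathcal{F}_n$. For a cycle $\hat\gamma$ put $h(\hat\gamma)=\sum_i\varpi^c(\gamma_i)f^*(\gamma_i)$ (an even number) and $\zeta(\hat\gamma)=|h(\hat\gamma)|/2$. If $\hat\gamma_1,\dots,\hat\gamma_m$ are the cycles of $E\sqcup E'$, then $F\,F'=z_{\zeta(\hat\gamma_1)}\cdots z_{\zeta(\hat\gamma_m)}(F*F')$. This makes $\mathrm{ATL}_n$ an associative unital algebra (unit: all pairs $\{(0,k),(1,k)\}$ labeled $0$). For $1\le i\le n-1$, $F_i\in\mathcal{F}_n$ has pairs $\{(0,i),(0,i+1)\}$ and $\{(1,i),(1,i+1)\}$ both labeled $1$, and $\{(0,k),(1,k)\}$ labeled $0$ for $k\ne i,i+1$. The relations $F_i^2=z_0F_i$, $F_iF_j=F_jF_i$ ($|i-j|\ge2$) and $F_iF_jF_i=F_i$ ($|i-j|=1$) hold in $\mathrm{ATL}_n$, so $\iota$ is well defined. *)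

theory Defs
  imports
    "HOL-Computational_Algebra.Polynomial"
    "HOL-Library.Poly_Mapping"
    "HOL-Library.Disjoint_Sets"
    "HOL-Library.FuncSet"
    "HOL-Algebra.QuotRing"
begin

section \<open>The Temperley--Lieb algebra\<close>

text \<open>
  Words form the free monoid under concatenation, written additively, so that the
  convolution product on \<^typ>\<open>nat list \<Rightarrow>\<^sub>0 int poly\<close> is that of the free associative
  algebra over \<open>\<int>[z]\<close> (with \<^typ>\<open>int poly\<close> for \<open>\<int>[z]\<close>).
\<close>

instantiation list :: (type) monoid_add
begin

definition zero_list_def: "0 = []"

definition plus_list_def: "xs + ys = xs @ ys"

instance
  by standard (simp_all add: zero_list_def plus_list_def)

end

type_synonym free_alg = "nat list \<Rightarrow>\<^sub>0 int poly"

definition free_algebra :: "nat \<Rightarrow> free_alg ring" where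
  "free_algebra n =
     \<lparr>carrier = {x. Poly_Mapping.keys x \<subseteq> lists {1..n-1}},
      mult = (*), one = 1, zero = 0, add = (+)\<rparr>"

definition free_scalar :: "int poly \<Rightarrow> free_alg" where
  "free_scalar c = Poly_Mapping.single [] c"

definition free_gen :: "nat \<Rightarrow> free_alg" where
  "free_gen i = Poly_Mapping.single [i] 1"

definition z_TL :: "int poly" where
  "z_TL = [:0, 1:]"

text \<open>Without this fact the ideal closure below could degenerate to the whole type.\<close>

lemma ring_free_algebra: "ring (free_algebra n)"
proof (rule ringI)
  show "abelian_group (free_algebra n)"
  proof (rule abelian_groupI)
    fix x y assume "x \<in> carrier (free_algebra n)" "y \<in> carrier (free_algebra n)"
    then show "x \<oplus>\<^bsub>free_algebra n\<^esub> y \<in> carrier (free_algebra n)"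
      using Poly_Mapping.keys_add[of x y] by (auto simp: free_algebra_def)
  next
    fix x assume "x \<in> carrier (free_algebra n)"
    then show "\<exists>y\<in>carrier (free_algebra n). y \<oplus>\<^bsub>free_algebra n\<^esub> x = \<zero>\<^bsub>free_algebra n\<^esub>"
      by (intro bexI[of _ "- x"]) (auto simp: free_algebra_def)
  qed (auto simp: free_algebra_def algebra_simps)
  show "monoid (free_algebra n)"
  proof (rule monoidI)
    fix x y assume "x \<in> carrier (free_algebra n)" "y \<in> carrier (free_algebra n)"
    then show "x \<otimes>\<^bsub>free_algebra n\<^esub> y \<in> carrier (free_algebra n)"
      using Poly_Mapping.keys_mult[of x y]
      by (fastforce simp: free_algebra_def plus_list_def)
  qed (auto simp: free_algebra_def zero_list_def algebra_simps)
qed (auto simp: free_algebra_def algebra_simps)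

definition TL_relators :: "nat \<Rightarrow> free_alg set" where
  "TL_relators n =
     {free_gen i * free_gen i - free_scalar z_TL * free_gen i | i. i \<in> {1..n-1}}
   \<union> {free_gen i * free_gen j - free_gen j * free_gen i | i j.
        i \<in> {1..n-1} \<and> j \<in> {1..n-1} \<and> \<bar>int i - int j\<bar> \<ge> 2}
   \<union> {free_gen i * free_gen j * free_gen i - free_gen i | i j.
        i \<in> {1..n-1} \<and> j \<in> {1..n-1} \<and> \<bar>int i - int j\<bar> = 1}"

definition TL_ideal :: "nat \<Rightarrow> free_alg set" where
  "TL_ideal n = Idl\<^bsub>free_algebra n\<^esub> (TL_relators n)"

definition TL :: "nat \<Rightarrow> free_alg set ring" where
  "TL n = free_algebra n Quot TL_ideal n"

definition TL_scalar :: "nat \<Rightarrow> int poly \<Rightarrow> free_alg set" where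
  "TL_scalar n c = TL_ideal n +>\<^bsub>free_algebra n\<^esub> free_scalar c"

definition TL_gen :: "nat \<Rightarrow> nat \<Rightarrow> free_alg set" where
  "TL_gen n i = TL_ideal n +>\<^bsub>free_algebra n\<^esub> free_gen i"


section \<open>Arrow flat tangles\<close>

text \<open>\<open>\<int>[z\<^sub>0, z\<^sub>1, \<dots>]\<close>: integer combinations of monomials, a monomial being its
  finitely supported exponent function.\<close>

type_synonym arrow_poly = "(nat \<Rightarrow>\<^sub>0 nat) \<Rightarrow>\<^sub>0 int"

definition z_ATL :: "nat \<Rightarrow> arrow_poly" where
  "z_ATL k = Poly_Mapping.single (Poly_Mapping.single k 1) 1"

type_synonym vertex = "nat \<times> nat"

definition vertices :: "nat \<Rightarrow> vertex set" where
  "vertices n = {0, 1} \<times> {1..n}"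

definition vless :: "vertex \<Rightarrow> vertex \<Rightarrow> bool" where
  "vless p q \<longleftrightarrow>
     fst p = 0 \<and> fst q = 0 \<and> snd p < snd q
   \<or> fst p = 0 \<and> fst q = 1
   \<or> fst p = 1 \<and> fst q = 1 \<and> snd q < snd p"

definition flat_tangles :: "nat \<Rightarrow> vertex set set set" where
  "flat_tangles n = {E. partition_on (vertices n) E \<and> (\<forall>\<alpha>\<in>E. card \<alpha> = 2)}"

text \<open>Labellings are extensional, so that pairs \<open>(E, f)\<close> are equal iff the labellings
  agree on \<open>E\<close>.\<close>

type_synonym arrow_tangle = "vertex set set \<times> (vertex set \<Rightarrow> int)"

definition arrow_tangles :: "nat \<Rightarrow> arrow_tangle set" where
  "arrow_tangles n =
     {(E, f). E \<in> flat_tangles n \<and> f \<in> E \<rightarrow>\<^sub>E UNIV \<and>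
        (\<forall>a b c d. {(a, b), (c, d)} \<in> E \<longrightarrow>
           (if a = c then odd (f {(a, b), (c, d)}) else even (f {(a, b), (c, d)})))}"

text \<open>
  An entry \<open>\<alpha>\<^sub>i = {(a\<^sub>i, b\<^sub>i\<^sub>-\<^sub>1), (c\<^sub>i, b\<^sub>i)}\<close> of a tuple in the disjoint union of \<open>E\<close> and \<open>E'\<close>
  is stored with the summand it lies in (\<open>First\<close> for \<open>E\<close>, \<open>Second\<close> for \<open>E'\<close>) and with its
  direction of traversal, from \<open>(a\<^sub>i, b\<^sub>i\<^sub>-\<^sub>1)\<close> to \<open>(c\<^sub>i, b\<^sub>i)\<close>.  For arcs and cycles the direction
  is determined by the underlying tuple of pairs, so this records no extra choice.
\<close>

datatype step =
    is_First: First (src: vertex) (tgt: vertex)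
  | is_Second: Second (src: vertex) (tgt: vertex)

definition pair_of :: "step \<Rightarrow> vertex set" where
  "pair_of s = {src s, tgt s}"

definition steps :: "vertex set set \<Rightarrow> vertex set set \<Rightarrow> step set" where
  "steps E E' = {s. if is_First s then pair_of s \<in> E else pair_of s \<in> E'}"

definition arcs :: "vertex set set \<Rightarrow> vertex set set \<Rightarrow> step list set" where
  "arcs E E' = {\<alpha>s. \<alpha>s \<noteq> [] \<and> set \<alpha>s \<subseteq> steps E E' \<and>
     (\<forall>i. Suc i < length \<alpha>s \<longrightarrow>
        snd (tgt (\<alpha>s ! i)) = snd (src (\<alpha>s ! Suc i)) \<and>
        (is_First (\<alpha>s ! i) \<longrightarrow>
           fst (tgt (\<alpha>s ! i)) = 1 \<and> is_Second (\<alpha>s ! Suc i) \<and> fst (src (\<alpha>s ! Suc i)) = 0) \<and>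
        (is_Second (\<alpha>s ! i) \<longrightarrow>
           fst (tgt (\<alpha>s ! i)) = 0 \<and> is_First (\<alpha>s ! Suc i) \<and> fst (src (\<alpha>s ! Suc i)) = 1)) \<and>
     fst (src (hd \<alpha>s)) = (if is_First (hd \<alpha>s) then 0 else 1) \<and>
     fst (tgt (last \<alpha>s)) = (if is_First (last \<alpha>s) then 0 else 1) \<and>
     vless (src (hd \<alpha>s)) (tgt (last \<alpha>s))}"

definition arc_boundary :: "step list \<Rightarrow> vertex set" where
  "arc_boundary \<alpha>s = {src (hd \<alpha>s), tgt (last \<alpha>s)}"

text \<open>List positions start at 0, so the odd-numbered entries of a cycle are those at
  even positions; the last conjuncts say \<open>b\<^sub>0 = b\<^sub>2\<^sub>p\<close> and \<open>b\<^sub>0 < b\<^sub>i\<close> for \<open>1 \<le> i \<le> 2p - 1\<close>.\<close>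

definition cycles :: "vertex set set \<Rightarrow> vertex set set \<Rightarrow> step list set" where
  "cycles E E' = {\<gamma>s. \<gamma>s \<noteq> [] \<and> even (length \<gamma>s) \<and> set \<gamma>s \<subseteq> steps E E' \<and>
     (\<forall>i < length \<gamma>s.
        (even i \<longrightarrow> is_First (\<gamma>s ! i) \<and> fst (src (\<gamma>s ! i)) = 1 \<and> fst (tgt (\<gamma>s ! i)) = 1) \<and>
        (odd i \<longrightarrow> is_Second (\<gamma>s ! i) \<and> fst (src (\<gamma>s ! i)) = 0 \<and> fst (tgt (\<gamma>s ! i)) = 0)) \<and>
     (\<forall>i. Suc i < length \<gamma>s \<longrightarrow> snd (tgt (\<gamma>s ! i)) = snd (src (\<gamma>s ! Suc i))) \<and>
     snd (tgt (last \<gamma>s)) = snd (src (hd \<gamma>s)) \<and>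
     (\<forall>i. Suc i < length \<gamma>s \<longrightarrow> snd (src (hd \<gamma>s)) < snd (tgt (\<gamma>s ! i)))}"

definition parity :: "step \<Rightarrow> int" where
  "parity s = (if fst (src s) = fst (tgt s) then - 1 else 1)"

definition cum_parity :: "step list \<Rightarrow> nat \<Rightarrow> int" where
  "cum_parity \<alpha>s i =
     (if vless (src (\<alpha>s ! i)) (tgt (\<alpha>s ! i))
      then \<Prod>j<i. parity (\<alpha>s ! j)
      else \<Prod>j\<le>i. parity (\<alpha>s ! j))"

definition step_label :: "(vertex set \<Rightarrow> int) \<Rightarrow> (vertex set \<Rightarrow> int) \<Rightarrow> step \<Rightarrow> int" where
  "step_label f f' s = (if is_First s then f (pair_of s) else f' (pair_of s))"

definition total_label :: "(vertex set \<Rightarrow> int) \<Rightarrow> (vertex set \<Rightarrow> int) \<Rightarrow> step list \<Rightarrow> int" where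
  "total_label f f' \<alpha>s = (\<Sum>i<length \<alpha>s. cum_parity \<alpha>s i * step_label f f' (\<alpha>s ! i))"

definition flat_star :: "vertex set set \<Rightarrow> vertex set set \<Rightarrow> vertex set set" where
  "flat_star E E' = arc_boundary ` arcs E E'"

definition arrow_star :: "arrow_tangle \<Rightarrow> arrow_tangle \<Rightarrow> arrow_tangle" where
  "arrow_star F F' = (case (F, F') of ((E, f), (E', f')) \<Rightarrow>
     (flat_star E E',
      \<lambda>\<beta>\<in>flat_star E E'. total_label f f' (THE \<alpha>s. \<alpha>s \<in> arcs E E' \<and> arc_boundary \<alpha>s = \<beta>)))"

definition zeta :: "(vertex set \<Rightarrow> int) \<Rightarrow> (vertex set \<Rightarrow> int) \<Rightarrow> step list \<Rightarrow> nat" where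
  "zeta f f' \<gamma>s = nat (\<bar>total_label f f' \<gamma>s\<bar> div 2)"

definition loop_factor :: "arrow_tangle \<Rightarrow> arrow_tangle \<Rightarrow> arrow_poly" where
  "loop_factor F F' = (case (F, F') of ((E, f), (E', f')) \<Rightarrow>
     \<Prod>\<gamma>s\<in>cycles E E'. z_ATL (zeta f f' \<gamma>s))"


section \<open>The arrow Temperley--Lieb algebra\<close>

type_synonym arrow_alg = "arrow_tangle \<Rightarrow>\<^sub>0 arrow_poly"

definition ATL_mult :: "arrow_alg \<Rightarrow> arrow_alg \<Rightarrow> arrow_alg" where
  "ATL_mult x y =
     (\<Sum>F\<in>Poly_Mapping.keys x. \<Sum>F'\<in>Poly_Mapping.keys y.
        Poly_Mapping.single (arrow_star F F')
          (Poly_Mapping.lookup x F * Poly_Mapping.lookup y F' * loop_factor F F'))"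

definition id_flat :: "nat \<Rightarrow> vertex set set" where
  "id_flat n = {{(0, k), (1, k)} | k. k \<in> {1..n}}"

definition id_arrow :: "nat \<Rightarrow> arrow_tangle" where
  "id_arrow n = (id_flat n, \<lambda>\<alpha>\<in>id_flat n. 0)"

definition ATL :: "nat \<Rightarrow> arrow_alg ring" where
  "ATL n =
     \<lparr>carrier = {x. Poly_Mapping.keys x \<subseteq> arrow_tangles n},
      mult = ATL_mult, one = Poly_Mapping.single (id_arrow n) 1, zero = 0, add = (+)\<rparr>"

definition ATL_scalar :: "nat \<Rightarrow> arrow_poly \<Rightarrow> arrow_alg" where
  "ATL_scalar n c = Poly_Mapping.single (id_arrow n) c"

definition hook_flat :: "nat \<Rightarrow> nat \<Rightarrow> vertex set set" where
  "hook_flat n i =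
     {{(0, i), (0, i + 1)}, {(1, i), (1, i + 1)}}
   \<union> {{(0, k), (1, k)} | k. k \<in> {1..n} - {i, i + 1}}"

definition hook_arrow :: "nat \<Rightarrow> nat \<Rightarrow> arrow_tangle" where
  "hook_arrow n i =
     (hook_flat n i,
      \<lambda>\<alpha>\<in>hook_flat n i. if \<alpha> \<in> {{(0, i), (0, i + 1)}, {(1, i), (1, i + 1)}} then 1 else 0)"

definition ATL_gen :: "nat \<Rightarrow> nat \<Rightarrow> arrow_alg" where
  "ATL_gen n i = Poly_Mapping.single (hook_arrow n i) 1"

end

theory Submission
  imports Defs
begin

text \<open>
  Every word in the generators reduces, modulo the relations and up to a power of \<open>z\<close>, to a Jones
  normal form: a product of descending runs \<open>E\<^sub>i E\<^sub>i\<^sub>-\<^sub>1 \<dots> E\<^sub>j\<close> whose tops \<open>i\<close> and bottoms \<open>j\<close> both increase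
  strictly. The image of a word is a monomial multiple of a single arrow tangle, so it suffices that
  different normal forms have different underlying flat tangles. This holds because the last run
  can be read off the tangle (last non-vertical strand and last cup at the bottom) and can then be
  undone. Labels play no role, and of the loop factors only that they are monomials.
\<close>

section \<open>Jones normal form\<close>

text \<open>Rewriting supplies only the existence of a normal form; its uniqueness is read off the
  tangles instead of from confluence. The product of tangles is defined through arcs of unbounded
  length, so words are evaluated from left to right, one hook multiplied on the right at a time:
  every arc exhibited then has at most five steps. Arcs only show that a pair belongs to a product;
  that a pair does not belong, or that two tangles agree, follows because a vertex of a perfect
  matching has just one partner. For this the products must be matchings, which is carried as the
  assumption \<open>tangle\<close> until the values of \<open>\<psi>\<close> provide it. As the
  labels of a product stay unknown, coefficients are compared after summing over all labellings of a
  flat tangle.\<close>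

inductive tl_step :: "nat list \<Rightarrow> nat list \<Rightarrow> bool" where
  square: "tl_step (p @ [i, i] @ q) (p @ [i] @ q)"
| commute: "i + 2 \<le> j \<or> j + 2 \<le> i \<Longrightarrow> tl_step (p @ [i, j] @ q) (p @ [j, i] @ q)"
| contract: "j = Suc i \<or> i = Suc j \<Longrightarrow> tl_step (p @ [i, j, i] @ q) (p @ [i] @ q)"

abbreviation tl_reduces :: "nat list \<Rightarrow> nat list \<Rightarrow> bool" (infix "\<leadsto>" 50) where
  "u \<leadsto> v \<equiv> tl_step\<^sup>*\<^sup>* u v"

lemma tl_step_context:
  assumes "tl_step u v" shows "tl_step (p @ u @ q) (p @ v @ q)"
  using assms
proof cases
  case (square p' i q')
  then show ?thesis using tl_step.square[of "p @ p'" i "q' @ q"] by simp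
next
  case (commute i j p' q')
  then show ?thesis using tl_step.commute[of i j "p @ p'" "q' @ q"] by simp
next
  case (contract j i p' q')
  then show ?thesis using tl_step.contract[of j i "p @ p'" "q' @ q"] by simp
qed

lemma tl_reduces_context: "u \<leadsto> v \<Longrightarrow> p @ u @ q \<leadsto> p @ v @ q"
  by (induction rule: rtranclp_induct) (auto intro: rtranclp.rtrancl_into_rtrancl tl_step_context)

lemma tl_reduces_append_right: "u \<leadsto> v \<Longrightarrow> u @ q \<leadsto> v @ q"
  using tl_reduces_context[of u v "[]" q] by simp

lemma tl_reduces_append_left: "u \<leadsto> v \<Longrightarrow> p @ u \<leadsto> p @ v"
  using tl_reduces_context[of u v p "[]"] by simp

lemma tl_reduces_length: "u \<leadsto> v \<Longrightarrow> length v \<le> length u"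
  by (induction rule: rtranclp_induct) (auto elim!: tl_step.cases)

lemma tl_reduces_set: "u \<leadsto> v \<Longrightarrow> set v \<subseteq> set u"
  by (induction rule: rtranclp_induct) (auto elim!: tl_step.cases)

lemma tl_reduces_Cons_commute:
  assumes "\<And>y. y \<in> set v \<Longrightarrow> x + 2 \<le> y \<or> y + 2 \<le> x"
  shows "x # v \<leadsto> v @ [x]"
  using assms
proof (induction v)
  case (Cons y v)
  have "x # y # v \<leadsto> y # x # v"
    using tl_step.commute[of x y "[]" v] Cons.prems[of y] by auto
  also have "y # x # v \<leadsto> y # v @ [x]"
    using tl_reduces_append_left[of "x # v" "v @ [x]" "[y]"] Cons by auto
  finally show ?case by simp
qed simp

lemma tl_reduces_commute:
  assumes "\<And>x y. x \<in> set u \<Longrightarrow> y \<in> set v \<Longrightarrow> x + 2 \<le> y \<or> y + 2 \<le> x"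
  shows "u @ v \<leadsto> v @ u"
  using assms
proof (induction u)
  case (Cons x u)
  have "x # u @ v \<leadsto> x # v @ u"
    using tl_reduces_append_left[of "u @ v" "v @ u" "[x]"] Cons by auto
  also have "x # v @ u \<leadsto> (v @ [x]) @ u"
    using tl_reduces_append_right[OF tl_reduces_Cons_commute, of v x u] Cons.prems by auto
  finally show ?case by simp
qed simp

section \<open>Descending runs and the existence of normal forms\<close>

definition run :: "nat \<Rightarrow> nat \<Rightarrow> nat list" where
  "run i j = rev [j..<Suc i]"

lemma set_run [simp]: "set (run i j) = {j..i}"
  by (auto simp: run_def)

lemma length_run [simp]: "length (run i j) = Suc i - j"
  by (simp add: run_def del: upt_Suc)

lemma run_single [simp]: "run i i = [i]"
  by (simp add: run_def)

lemma run_append: "k \<le> i \<Longrightarrow> j \<le> Suc k \<Longrightarrow> run i (Suc k) @ run k j = run i j"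
  unfolding run_def rev_append[symmetric]
  by (metis upt_add_eq_append Suc_le_mono le_Suc_ex)

lemma run_snoc: "j \<le> i \<Longrightarrow> run i j = run i (Suc j) @ [j]"
  using run_append[of j i j] by simp

lemma run_Cons: "j \<le> i \<Longrightarrow> run i j = i # rev [j..<i]"
  by (simp add: run_def)

text \<open>This repairs two runs whose tops increase but whose bottoms do not. The final
  \<open>a\<close> of the first run commutes past the letters above \<open>Suc a\<close> of the
  second, so that \<open>a, Suc a, a\<close> contracts; \<open>run a b\<close> then moves left and
  completes the first run. Two letters are lost. For \<open>i = Suc a\<close> nothing remains of the
  second run.\<close>

lemma run_run_reduces:
  assumes "i' < i" "b \<le> a" "a \<le> i'"
  shows "run i' a @ run i b \<leadsto> run i' b @ run i (a + 2)"
proof -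
  define t where "t = rev [b..<a]"
  have t: "run a b = a # t" using run_Cons[of b a] assms by (simp add: t_def)
  have "run i b = run i (a + 2) @ run (Suc a) b"
    using run_append[of "Suc a" i b] assms by simp
  also have "run (Suc a) b = [Suc a] @ a # t"
    using run_append[of a "Suc a" b] assms by (simp flip: t)
  finally have "run i' a @ run i b = run i' (Suc a) @ ([a] @ run i (a + 2)) @ [Suc a, a] @ t"
    using run_snoc[of a i'] assms by simp
  also have "\<dots> \<leadsto> run i' (Suc a) @ (run i (a + 2) @ [a]) @ [Suc a, a] @ t"
    by (intro tl_reduces_context tl_reduces_commute) auto
  also have "\<dots> = (run i' (Suc a) @ run i (a + 2)) @ [a, Suc a, a] @ t" by simp
  also have "\<dots> \<leadsto> (run i' (Suc a) @ run i (a + 2)) @ [a] @ t"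
    by (intro r_into_rtranclp tl_step.contract) simp
  also have "\<dots> = run i' (Suc a) @ (run i (a + 2) @ run a b)" by (simp add: t)
  also have "\<dots> \<leadsto> run i' (Suc a) @ (run a b @ run i (a + 2))"
    by (intro tl_reduces_append_left tl_reduces_commute) auto
  also have "\<dots> = run i' b @ run i (a + 2)"
    using run_append[of a i' b] assms by (simp flip: append_assoc)
  finally show ?thesis .
qed

text \<open>In the run, \<open>c\<close> is followed by \<open>c - 1\<close>; all letters after that
  pair are at most \<open>c - 2\<close> and let the new \<open>c\<close> pass, which creates the
  contractible \<open>c, c - 1, c\<close>.\<close>

lemma run_snoc_reduces:
  assumes "b < c" "c \<le> i"
  shows "\<exists>v. run i b @ [c] \<leadsto> v \<and> length v < length (run i b @ [c])"
proof -
  obtain d where d: "c = Suc d" using assms by (cases c) auto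
  define t where "t = rev [b..<d]"
  have t: "run d b = d # t" using run_Cons[of b d] assms d by (simp add: t_def)
  have "run c b = [c] @ d # t" using run_append[of d c b] assms d by (simp flip: t)
  then have r: "run i b = run i (Suc c) @ [c, d] @ t"
    using run_append[of c i b] assms by simp
  have "run i b @ [c] = (run i (Suc c) @ [c, d]) @ (t @ [c])" by (simp add: r)
  also have "\<dots> \<leadsto> (run i (Suc c) @ [c, d]) @ ([c] @ t)"
    by (intro tl_reduces_append_left tl_reduces_commute) (auto simp: t_def d)
  also have "\<dots> = run i (Suc c) @ [c, d, c] @ t" by simp
  also have "\<dots> \<leadsto> run i (Suc c) @ [c] @ t"
    by (intro r_into_rtranclp tl_step.contract) (simp add: d)
  finally show ?thesis by (intro exI conjI) (auto simp: r)
qed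

text \<open>The indices are the top and the bottom of the last run. The value 0 for the empty word
  lies below every generator index, so the first run obeys the same inequalities as the later ones
  and all letters are positive.\<close>

inductive jones :: "nat \<Rightarrow> nat \<Rightarrow> nat list \<Rightarrow> bool" where
  Nil: "jones 0 0 []"
| append_run: "jones i' j' u \<Longrightarrow> i' < i \<Longrightarrow> j' < j \<Longrightarrow> j \<le> i \<Longrightarrow> jones i j (u @ run i j)"

lemma jones_le: "jones i j w \<Longrightarrow> j \<le> i"
  by (induction rule: jones.induct) auto

lemma jones_set: "jones i j w \<Longrightarrow> set w \<subseteq> {1..i}"
  by (induction rule: jones.induct) force+

lemma jones_top_mem: "jones i j w \<Longrightarrow> 0 < i \<Longrightarrow> i \<in> set w"
  by (induction rule: jones.induct) auto

text \<open>With the tops in order, the only defect is a bottom that fails to increase;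
  \<open>run_run_reduces\<close> on the last two runs then loses two letters.\<close>

lemma jones_append_run_reduces:
  assumes "jones i' j' u" "i' < i" "b \<le> j'" "0 < b"
  shows "\<exists>v. u @ run i b \<leadsto> v \<and> length v < length (u @ run i b)"
  using assms(1)
proof cases
  case Nil
  then show ?thesis using assms by simp
next
  case (append_run i'' j'' p)
  have "p @ run i' j' @ run i b \<leadsto> p @ run i' b @ run i (j' + 2)"
    using assms append_run by (intro tl_reduces_append_left run_run_reduces) auto
  then show ?thesis using append_run assms jones_le[OF assms(1)]
    by (intro exI[of _ "p @ run i' b @ run i (j' + 2)"]) auto
qed

text \<open>A letter appended to a normal form leads either to a Jones word again or to a strictly
  shorter word, which the induction on length handles.\<close>

lemma reduces_to_jones:
  assumes "0 \<notin> set w"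
  shows "\<exists>i j v. w \<leadsto> v \<and> jones i j v"
  using assms
proof (induction w rule: length_induct)
  case (1 w)
  have shorter: ?case if "w \<leadsto> v" "length v < length w" for v
    using 1 that tl_reduces_set[OF that(1)] by (meson rtranclp_trans subsetD)
  show ?case
  proof (cases w rule: rev_cases)
    case Nil
    then show ?thesis using jones.Nil by blast
  next
    case (snoc v c)
    then obtain i j v1 where v1: "v \<leadsto> v1" "jones i j v1" using 1 by fastforce
    have w: "w \<leadsto> v1 @ [c]" and c: "0 < c"
      using v1(1) tl_reduces_append_right 1(2) snoc by auto
    have len: "length v1 \<le> length v" using v1(1) by (rule tl_reduces_length)
    have shorter': ?thesis if "v1 @ [c] \<leadsto> x" "length x < length (v1 @ [c])" for x
      using shorter[of x] that w len snoc by (auto dest: rtranclp_trans)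
    show ?thesis using v1(2)
    proof cases
      case Nil
      then have "jones c c (v1 @ [c])" using jones.append_run[OF jones.Nil, of c c] c by simp
      then show ?thesis using w by blast
    next
      case (append_run i' j' u)
      have u: "set u \<subseteq> {1..i'}" using append_run jones_set by blast
      \<comment> \<open>Relative to the last run, \<open>c\<close> starts a new run, is absorbed by
        a square, forces a contraction, extends the run downwards, or commutes past all of
        it.\<close>
      consider "i < c" | "c = j" | "j < c" "c \<le> i" | "Suc c = j" | "Suc c < j" by linarith
      then show ?thesis
      proof cases
        case 1
        then have "jones c c (v1 @ run c c)"
          using v1(2) jones_le[OF v1(2)] by (intro jones.append_run[of i j]) auto
        then show ?thesis using w by auto
      next
        case 2
        have "tl_step (v1 @ [c]) v1"
          using tl_step.square[of "u @ run i (Suc j)" j "[]"] append_run run_snoc[of j i] 2 by simp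
        then show ?thesis using w v1(2) by (meson rtranclp.rtrancl_into_rtrancl)
      next
        case 3
        then obtain x where "run i j @ [c] \<leadsto> x" "length x < length (run i j @ [c])"
          using run_snoc_reduces by blast
        then show ?thesis
          using shorter'[of "u @ x"] tl_reduces_append_left[of _ x u] append_run by auto
      next
        case 4
        then have e: "v1 @ [c] = u @ run i c" using run_snoc[of c i] append_run by simp
        show ?thesis
        proof (cases "j' < c")
          case True
          then have "jones i c (u @ run i c)" using 4 append_run by (intro jones.append_run) auto
          then show ?thesis using w e by auto
        next
          case False
          then show ?thesis
            using jones_append_run_reduces[of i' j' u i c] append_run(2,3) c shorter' e
            by (metis not_less)
        qed
      next
        case 5
        have "run i j @ [c] \<leadsto> [c] @ run i j" using 5 by (intro tl_reduces_commute) auto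
        then have a: "v1 @ [c] \<leadsto> (u @ [c]) @ run i j"
          using tl_reduces_append_left[of _ _ u] append_run by simp
        \<comment> \<open>The last run is nonempty, so \<open>u @ [c]\<close> is shorter than
          \<open>w\<close> and is normalised by itself. Its letters stay below \<open>i\<close>,
          hence the tops still increase when the run is put back.\<close>
        have "length (u @ [c]) < length w" "0 \<notin> set (u @ [c])"
          using append_run len snoc u c by auto
        then obtain i2 j2 p where p: "u @ [c] \<leadsto> p" "jones i2 j2 p" using "1.IH" by blast
        have b: "v1 @ [c] \<leadsto> p @ run i j"
          using a tl_reduces_append_right[OF p(1)] by (meson rtranclp_trans)
        have "set p \<subseteq> {1..<i}" using tl_reduces_set[OF p(1)] u append_run c 5 by fastforce
        then have i2: "i2 < i" using jones_top_mem[OF p(2)] append_run by (cases "i2 = 0") auto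
        show ?thesis
        proof (cases "j2 < j")
          case True
          then have "jones i j (p @ run i j)" using p i2 append_run by (intro jones.append_run) auto
          then show ?thesis using w b by (meson rtranclp_trans)
        next
          case False
          then obtain x where x: "p @ run i j \<leadsto> x" "length x < length (p @ run i j)"
            using jones_append_run_reduces[of i2 j2 p i j] p i2 5 by auto
          have "length (p @ run i j) \<le> length (v1 @ [c])" using b by (rule tl_reduces_length)
          then show ?thesis using shorter'[of x] x b by (meson rtranclp_trans order.strict_trans2)
        qed
      qed
    qed
  qed
qed

section \<open>Flat tangles of Jones words\<close>

lemma flat_tangle_partner_unique:
  assumes "E \<in> flat_tangles n" "{p, q} \<in> E" "{p, q'} \<in> E"
  shows "q = q'"
proof -
  have "disjoint E" using assms(1) by (simp add: flat_tangles_def partition_on_def)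
  then have "{p, q} = {p, q'}" using assms(2,3) by (auto dest: disjointD)
  then show ?thesis by (auto simp: doubleton_eq_iff)
qed

lemma flat_tangle_pairs_disjoint:
  assumes "E \<in> flat_tangles n" "\<alpha> \<in> E" "\<beta> \<in> E" "\<alpha> \<noteq> \<beta>"
  shows "\<alpha> \<inter> \<beta> = {}"
proof (rule disjointD[OF _ assms(2-4)])
  show "disjoint E" using assms(1) by (simp add: flat_tangles_def partition_on_def)
qed

lemma flat_tangle_pair:
  assumes "E \<in> flat_tangles n" "{p, q} \<in> E"
  shows "p \<noteq> q" "p \<in> vertices n" "q \<in> vertices n"
proof -
  have "card {p, q} = 2" "{p, q} \<subseteq> vertices n"
    using assms by (auto simp: flat_tangles_def partition_on_def)
  then show "p \<noteq> q" "p \<in> vertices n" "q \<in> vertices n" by (auto simp: card_insert_if)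
qed

lemma flat_tangle_partner_exists:
  assumes "E \<in> flat_tangles n" "p \<in> vertices n"
  obtains q where "{p, q} \<in> E"
proof -
  obtain \<alpha> where a: "\<alpha> \<in> E" "p \<in> \<alpha>" "card \<alpha> = 2"
    using assms by (auto simp: flat_tangles_def partition_on_def)
  then obtain x y where "\<alpha> = {x, y}" by (auto simp: card_2_iff)
  then have "{p, if p = x then y else x} \<in> E" using a by (auto simp: insert_commute)
  then show ?thesis by (rule that)
qed

text \<open>Both are perfect matchings of the same vertex set, so an inclusion already forces
  equality.\<close>

lemma flat_tangle_eqI:
  assumes "E \<in> flat_tangles n" "R \<in> flat_tangles n"
    and sub: "\<And>p q. {p, q} \<in> E \<Longrightarrow> {p, q} \<in> R"
  shows "E = R"
proof -
  have ex: "\<exists>p q. \<alpha> = {p, q}" if "\<alpha> \<in> E \<or> \<alpha> \<in> R" for \<alpha>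
  proof -
    have "card \<alpha> = 2" using that assms(1,2) by (auto simp: flat_tangles_def)
    then show ?thesis unfolding card_2_iff by blast
  qed
  have "{p, q} \<in> E" if pq: "{p, q} \<in> R" for p q
  proof -
    obtain q' where q': "{p, q'} \<in> E"
      using flat_tangle_partner_exists[OF assms(1) flat_tangle_pair(2)[OF assms(2) pq]] .
    have "q' = q"
      using flat_tangle_partner_unique[OF assms(2) sub[OF q'] pq] .
    then show ?thesis using q' by simp
  qed
  then show ?thesis using ex sub by (metis subsetI subset_antisym)
qed

section \<open>Arcs in a product of flat tangles\<close>

lemma vless_total:
  assumes "p \<in> vertices n" "q \<in> vertices n" "p \<noteq> q"
  shows "vless p q \<or> vless q p"
proof -
  have "fst p = 0 \<or> fst p = 1" "fst q = 0 \<or> fst q = 1"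
    using assms by (auto simp: vertices_def)
  moreover have "fst p = fst q \<Longrightarrow> snd p < snd q \<or> snd q < snd p"
    using assms(3) prod_eqI nat_neq_iff by blast
  ultimately show ?thesis unfolding vless_def by argo
qed

text \<open>Meant for the second factor of a product: a vertex of the first factor that is on the
  outer boundary already, or from which the arc continues straight down, becomes the outer vertex of
  the same name.\<close>

definition through :: "vertex set set \<Rightarrow> vertex \<Rightarrow> bool" where
  "through E x \<longleftrightarrow> fst x = 0 \<or> fst x = 1 \<and> {(0, snd x), (1, snd x)} \<in> E"

text \<open>The gluing condition of \<open>arcs\<close> on two consecutive steps, isolated so that
  \<open>successively\<close> evaluates it on explicit lists.\<close>

definition joins :: "step \<Rightarrow> step \<Rightarrow> bool" where
  "joins s t \<longleftrightarrow> snd (tgt s) = snd (src t) \<and>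
     (is_First s \<longrightarrow> fst (tgt s) = 1 \<and> is_Second t \<and> fst (src t) = 0) \<and>
     (is_Second s \<longrightarrow> fst (tgt s) = 0 \<and> is_First t \<and> fst (src t) = 1)"

lemma arcsI:
  assumes "xs \<noteq> []" "set xs \<subseteq> steps E E'" "successively joins xs"
    and "fst (src (hd xs)) = (if is_First (hd xs) then 0 else 1)"
    and "fst (tgt (last xs)) = (if is_First (last xs) then 0 else 1)"
    and "vless (src (hd xs)) (tgt (last xs))"
  shows "xs \<in> arcs E E'"
  using assms unfolding arcs_def successively_conv_nth joins_def by blast

lemma flat_star_through_vless:
  assumes "{p, q} \<in> E" "through E' p" "through E' q" "vless p q"
  shows "{p, q} \<in> flat_star E E'"
proof -
  \<comment> \<open>From a bottom vertex the arc first climbs the vertical strand of the second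
    factor; from a top vertex it starts directly in the first. The other end is treated
    alike.\<close>
  define xs where "xs = (if fst p = 0 then [] else [Second p (0, snd p)]) @ [First p q]
      @ (if fst q = 0 then [] else [Second (0, snd q) q])"
  have "{p, (0, snd p)} \<in> E'" if "fst p \<noteq> 0"
    using assms that by (cases p) (simp add: through_def insert_commute)
  moreover have "{(0, snd q), q} \<in> E'" if "fst q \<noteq> 0"
    using assms that by (cases q) (simp add: through_def)
  ultimately have "set xs \<subseteq> steps E E'"
    using assms(1) by (simp add: xs_def steps_def pair_of_def)
  moreover have "fst p \<in> {0, 1}" "fst q \<in> {0, 1}" using assms by (auto simp: through_def)
  ultimately have "xs \<in> arcs E E'"
    using \<open>vless p q\<close> unfolding xs_def by (intro arcsI) (auto simp: joins_def)
  moreover have "arc_boundary xs = {p, q}" by (simp add: arc_boundary_def xs_def)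
  ultimately show ?thesis by (auto simp: flat_star_def)
qed

lemma flat_star_through:
  assumes "E \<in> flat_tangles n" "{p, q} \<in> E" "through E' p" "through E' q"
  shows "{p, q} \<in> flat_star E E'"
proof -
  consider "vless p q" | "vless q p"
    using flat_tangle_pair[OF assms(1,2)] vless_total by blast
  then show ?thesis
  proof cases
    case 1
    then show ?thesis using flat_star_through_vless assms by simp
  next
    case 2
    then show ?thesis
      using flat_star_through_vless[of q p] assms unfolding insert_commute[of q p] by simp
  qed
qed

lemma flat_star_cap_vless:
  assumes "{p, (1, x)} \<in> E" "{q, (1, y)} \<in> E" "{(0, x), (0, y)} \<in> E'"
    and "through E' p" "through E' q" "vless p q"
  shows "{p, q} \<in> flat_star E E'"
proof -
  define xs where "xs = (if fst p = 0 then [] else [Second p (0, snd p)])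
      @ [First p (1, x), Second (0, x) (0, y), First (1, y) q]
      @ (if fst q = 0 then [] else [Second (0, snd q) q])"
  have "{p, (0, snd p)} \<in> E'" if "fst p \<noteq> 0"
    using assms that by (cases p) (simp add: through_def insert_commute)
  moreover have "{(0, snd q), q} \<in> E'" if "fst q \<noteq> 0"
    using assms that by (cases q) (simp add: through_def)
  ultimately have "set xs \<subseteq> steps E E'"
    using assms(1-3) by (simp add: xs_def steps_def pair_of_def insert_commute[of q])
  moreover have "fst p \<in> {0, 1}" "fst q \<in> {0, 1}" using assms by (auto simp: through_def)
  ultimately have "xs \<in> arcs E E'"
    using \<open>vless p q\<close> unfolding xs_def by (intro arcsI) (auto simp: joins_def)
  moreover have "arc_boundary xs = {p, q}" by (simp add: arc_boundary_def xs_def)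
  ultimately show ?thesis by (auto simp: flat_star_def)
qed

text \<open>The order runs backwards along the bottom, so the arc starts at the larger
  position.\<close>

lemma flat_star_bottom:
  assumes "{(1, x), (1, y)} \<in> E'" "y < x"
  shows "{(1, x), (1, y)} \<in> flat_star E E'"
proof -
  have "[Second (1, x) (1, y)] \<in> arcs E E'"
    using assms by (auto simp: arcs_def steps_def pair_of_def vless_def)
  then show ?thesis by (force simp: flat_star_def arc_boundary_def)
qed

section \<open>Right multiplication by a hook\<close>

lemma through_hook:
  assumes "x \<in> vertices n" "x \<noteq> (1, i)" "x \<noteq> (1, Suc i)"
  shows "through (hook_flat n i) x"
proof (cases "fst x = 0")
  case False
  then have x: "x = (1, snd x)" "snd x \<in> {1..n} - {i, i + 1}"
    using assms by (cases x; auto simp: vertices_def)+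
  then have "{(0, snd x), (1, snd x)} \<in> hook_flat n i" unfolding hook_flat_def by blast
  then show ?thesis using x(1) unfolding through_def by (metis fst_conv)
qed (simp add: through_def)

lemma flat_star_hook_cup: "{(1, i), (1, Suc i)} \<in> flat_star E (hook_flat n i)"
  using flat_star_bottom[of "Suc i" i "hook_flat n i" E]
  unfolding insert_commute[of "(1, Suc i)"] by (simp add: hook_flat_def)

lemma flat_star_hook_other:
  assumes "E \<in> flat_tangles n" "{p, q} \<in> E" "{p, q} \<inter> {(1, i), (1, Suc i)} = {}"
  shows "{p, q} \<in> flat_star E (hook_flat n i)"
  using assms(3) flat_tangle_pair[OF assms(1,2)]
  by (intro flat_star_through[OF assms(1,2)] through_hook) auto

text \<open>The strands arriving at positions \<open>i\<close> and \<open>Suc i\<close> are joined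
  by the cap of the hook. The excluded case \<open>p = (1, Suc i)\<close> is the one in which they
  close up to a loop.\<close>

lemma flat_star_hook_join:
  assumes "E \<in> flat_tangles n" "{p, (1, i)} \<in> E" "{q, (1, Suc i)} \<in> E" "p \<noteq> (1, Suc i)"
  shows "{p, q} \<in> flat_star E (hook_flat n i)"
proof -
  note P = flat_tangle_pair[OF assms(1,2)] and Q = flat_tangle_pair[OF assms(1,3)]
  have "q \<noteq> (1, i)"
    using flat_tangle_partner_unique[OF assms(1), of "(1, i)" p "(1, Suc i)"] assms
    by (auto simp: insert_commute)
  then have t: "through (hook_flat n i) p" "through (hook_flat n i) q"
    using assms P Q by (auto intro!: through_hook)
  have "p \<noteq> q"
    using flat_tangle_partner_unique[OF assms(1), of p "(1, i)" "(1, Suc i)"] assms by auto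
  moreover have "{(0, i), (0, Suc i)} \<in> hook_flat n i" "{(0, Suc i), (0, i)} \<in> hook_flat n i"
    by (auto simp: hook_flat_def insert_commute)
  ultimately show ?thesis
    using flat_star_cap_vless[OF assms(2,3) _ t] flat_star_cap_vless[OF assms(3,2) _ t(2,1)]
      vless_total[of p n q] P Q by (auto simp: insert_commute)
qed

text \<open>All vertices are \<open>through\<close> the identity, so every pair of \<open>E\<close>
  survives, and an inclusion of matchings is an equality.\<close>

lemma flat_star_id:
  assumes "E \<in> flat_tangles n" "flat_star E (id_flat n) \<in> flat_tangles n"
  shows "flat_star E (id_flat n) = E"
proof (rule flat_tangle_eqI[symmetric, OF assms])
  fix p q assume pq: "{p, q} \<in> E"
  have "through (id_flat n) (a, b)" if "(a, b) \<in> vertices n" for a b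
    using that unfolding through_def id_flat_def vertices_def fst_conv snd_conv by blast
  then show "{p, q} \<in> flat_star E (id_flat n)"
    using flat_tangle_pair[OF assms(1) pq] flat_star_through[OF assms(1) pq]
    by (cases p, cases q) blast
qed

section \<open>Effect of a run on a flat tangle\<close>

definition flat_word :: "nat \<Rightarrow> vertex set set \<Rightarrow> nat list \<Rightarrow> vertex set set" where
  "flat_word n = foldl (\<lambda>E i. flat_star E (hook_flat n i))"

lemma flat_word_simps [simp]:
  "flat_word n E [] = E"
  "flat_word n E (u @ v) = flat_word n (flat_word n E u) v"
  "flat_word n E (i # v) = flat_word n (flat_star E (hook_flat n i)) v"
  by (simp_all add: flat_word_def)

text \<open>Multiplying a tangle whose strand at \<open>i + 1\<close> is vertical by the run from \<open>i\<close> down to \<open>j\<close> creates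
  the cup at \<open>j\<close> and moves the remaining bottom vertices as follows; in particular \<open>(1, i)\<close> is pulled
  up to \<open>(0, i + 1)\<close>.\<close>

definition run_shift :: "nat \<Rightarrow> nat \<Rightarrow> vertex \<Rightarrow> vertex" where
  "run_shift i j p =
     (if fst p = 1 \<and> snd p = i then (0, Suc i)
      else if fst p = 1 \<and> j \<le> snd p \<and> snd p < i then (1, snd p + 2) else p)"

lemma flat_word_run_cup: "j \<le> i \<Longrightarrow> {(1, j), (1, Suc j)} \<in> flat_word n E (run i j)"
  by (simp add: run_snoc flat_star_hook_cup del: One_nat_def)

text \<open>Downward induction from \<open>j = i\<close>, one hook at a time. The first hook joins
  the strand at \<open>(1, i)\<close> to the vertical strand at \<open>Suc i\<close> and so pulls it
  up; each further hook at \<open>j\<close> meets the cup left at \<open>Suc j\<close> by its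
  predecessor, which carries \<open>(1, j)\<close> to \<open>(1, j + 2)\<close>.\<close>

lemma flat_word_run:
  assumes tangle: "\<And>m. j \<le> m \<Longrightarrow> flat_word n E (run i m) \<in> flat_tangles n"
    and strand: "{(0, Suc i), (1, Suc i)} \<in> E"
    and pq: "{p, q} \<in> E" "{p, q} \<noteq> {(0, Suc i), (1, Suc i)}"
    and j: "j \<le> i"
  shows "{run_shift i j p, run_shift i j q} \<in> flat_word n E (run i j)"
  using j tangle
proof (induction j rule: inc_induct)
  case base
  \<comment> \<open>\<open>run i (Suc i)\<close> is empty, so the case \<open>Suc i\<close> of the
    assumption speaks of \<open>E\<close> itself.\<close>
  have E: "E \<in> flat_tangles n" using base[of "Suc i"] by (simp add: run_def)
  have out: "p \<noteq> (1, Suc i)" "q \<noteq> (1, Suc i)"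
    using flat_tangle_pairs_disjoint[OF E pq(1) strand pq(2)] by blast+
  have sh: "run_shift i i x = (if x = (1, i) then (0, Suc i) else x)" for x
    by (cases x) (auto simp: run_shift_def)
  have *: "{(0, Suc i), y} \<in> flat_star E (hook_flat n i)"
    if "{(1, i), y} \<in> E" "y \<noteq> (1, Suc i)" for y
    using flat_star_hook_join[OF E, of y i "(0, Suc i)"] that strand
    unfolding insert_commute[of y] by blast
  have pq': "{q, p} \<in> E" "p \<noteq> q"
    using pq flat_tangle_pair[OF E pq(1)] by (simp_all add: insert_commute)
  consider "p = (1, i)" | "q = (1, i)" "p \<noteq> (1, i)" | "p \<noteq> (1, i)" "q \<noteq> (1, i)" by blast
  then show ?case
  proof cases
    case 1
    then show ?thesis using *[of q] pq pq' out by (simp add: sh)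
  next
    case 2
    then show ?thesis using *[of p] pq' out by (simp add: sh insert_commute[of p])
  next
    case 3
    then show ?thesis using flat_star_hook_other[OF E pq(1), of i] out by (simp add: sh)
  qed
next
  case (step j)
  let ?G = "flat_word n E (run i (Suc j))"
  have IH: "{run_shift i (Suc j) p, run_shift i (Suc j) q} \<in> ?G"
    using step by (meson Suc_leD)
  have G: "?G \<in> flat_tangles n" using step.prems[of "Suc j"] by simp
  have cup: "{(1, Suc j), (1, j + 2)} \<in> ?G"
    using flat_word_run_cup[of "Suc j" i n E] step.hyps by simp
  have sh: "run_shift i j x = (if run_shift i (Suc j) x = (1, j) then (1, j + 2) else run_shift i (Suc j) x)" for x
    using step.hyps by (cases x) (auto simp: run_shift_def)
  have r: "run i j = run i (Suc j) @ [j]" using step.hyps by (simp add: run_snoc)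
  have *: "{(1, j + 2), y} \<in> flat_star ?G (hook_flat n j)"
    if "{(1, j), y} \<in> ?G" for y
  proof -
    have "{(1, j), y} \<noteq> {(1, Suc j), (1, j + 2)}" by (auto simp: doubleton_eq_iff)
    then have "y \<noteq> (1, Suc j)" using flat_tangle_pairs_disjoint[OF G that cup] by auto
    then show ?thesis
      using flat_star_hook_join[OF G, of y j "(1, j + 2)"] that cup
      unfolding insert_commute[of y] insert_commute[of "(1, j + 2)" "(1, Suc j)"] by blast
  qed
  define p' q' where "p' = run_shift i (Suc j) p" and "q' = run_shift i (Suc j) q"
  have out: "p' \<noteq> (1, Suc j)" "q' \<noteq> (1, Suc j)"
    unfolding p'_def q'_def using step.hyps by (auto simp: run_shift_def prod_eq_iff split: if_splits)
  have pq': "{p', q'} \<in> ?G" "{q', p'} \<in> ?G" "p' \<noteq> q'"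
    using IH flat_tangle_pair[OF G IH] by (simp_all add: insert_commute p'_def q'_def)
  have goal: "?case \<longleftrightarrow> {if p' = (1, j) then (1, j + 2) else p', if q' = (1, j) then (1, j + 2) else q'}
      \<in> flat_star ?G (hook_flat n j)"
    by (simp add: r sh p'_def q'_def)
  consider "p' = (1, j)" | "q' = (1, j)" "p' \<noteq> (1, j)" | "p' \<noteq> (1, j)" "q' \<noteq> (1, j)" by blast
  then show ?case
    unfolding goal
  proof cases
    case 1
    then show "{if p' = (1, j) then (1, j + 2) else p', if q' = (1, j) then (1, j + 2) else q'}
      \<in> flat_star ?G (hook_flat n j)" using *[of q'] pq' by simp
  next
    case 2
    then show "{if p' = (1, j) then (1, j + 2) else p', if q' = (1, j) then (1, j + 2) else q'}
      \<in> flat_star ?G (hook_flat n j)" using *[of p'] pq' by (simp add: insert_commute[of p'])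
  next
    case 3
    then show "{if p' = (1, j) then (1, j + 2) else p', if q' = (1, j) then (1, j + 2) else q'}
      \<in> flat_star ?G (hook_flat n j)"
      using flat_star_hook_other[OF G pq'(1), of j] out by simp
  qed
qed

text \<open>The new places, bottom positions \<open>j + 2\<close> to \<open>Suc i\<close> and
  \<open>(0, Suc i)\<close>, are vacated by the shift itself and by leaving out the vertical strand;
  \<open>h\<close> moves everything back.\<close>

lemma run_shift_inj:
  assumes "run_shift i j p = run_shift i j q"
    and "p \<notin> {(0, Suc i), (1, Suc i)}" "q \<notin> {(0, Suc i), (1, Suc i)}"
  shows "p = q"
proof -
  define h :: "vertex \<Rightarrow> vertex" where "h x =
    (if x = (0, Suc i) then (1, i)
     else if fst x = 1 \<and> j + 2 \<le> snd x \<and> snd x \<le> Suc i then (1, snd x - 2) else x)" for x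
  have "h (run_shift i j (a, b)) = (a, b)" if "(a, b) \<notin> {(0, Suc i), (1, Suc i)}" for a b
    using that unfolding h_def run_shift_def by (cases "a = 1") auto
  then show ?thesis using assms by (metis surj_pair)
qed

text \<open>Off the vertical strand, partners in the product are the shifted partners in the
  original tangle, and the shift is injective there.\<close>

lemma flat_word_run_inj:
  assumes tangle1: "\<And>m. j \<le> m \<Longrightarrow> flat_word n E (run i m) \<in> flat_tangles n"
    and tangle2: "\<And>m. j \<le> m \<Longrightarrow> flat_word n E' (run i m) \<in> flat_tangles n"
    and strand: "{(0, Suc i), (1, Suc i)} \<in> E" "{(0, Suc i), (1, Suc i)} \<in> E'"
    and eq: "flat_word n E (run i j) = flat_word n E' (run i j)"
    and j: "j \<le> i"
  shows "E = E'"
proof (rule flat_tangle_eqI)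
  show E: "E \<in> flat_tangles n" and E': "E' \<in> flat_tangles n"
    using tangle1[of "Suc i"] tangle2[of "Suc i"] j by (simp_all add: run_def)
  fix p q assume pq: "{p, q} \<in> E"
  show "{p, q} \<in> E'"
  proof (cases "{p, q} = {(0, Suc i), (1, Suc i)}")
    case False
    have out: "p \<notin> {(0, Suc i), (1, Suc i)}" "q \<notin> {(0, Suc i), (1, Suc i)}"
      using flat_tangle_pairs_disjoint[OF E pq strand(1) False] by auto
    obtain q' where q': "{p, q'} \<in> E'"
      using flat_tangle_partner_exists[OF E'] flat_tangle_pair[OF E pq] by blast
    have ne: "{p, q'} \<noteq> {(0, Suc i), (1, Suc i)}" using out by auto
    have "q' \<notin> {(0, Suc i), (1, Suc i)}"
      using flat_tangle_pairs_disjoint[OF E' q' strand(2) ne] by auto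
    moreover have "run_shift i j q = run_shift i j q'"
      using flat_word_run[OF tangle1 strand(1) pq False j]
        flat_word_run[OF tangle2 strand(2) q' ne j] eq
      by (intro flat_tangle_partner_unique[OF tangle1[of j]]) auto
    ultimately show ?thesis using run_shift_inj[of i j q q'] out q' by simp
  next
    case True
    then show ?thesis using strand(2) by simp
  qed
qed

text \<open>The last run of a Jones word can be read off its flat tangle: \<open>i + 1\<close> is the last strand
  that is not vertical, and \<open>j\<close> is the position of the last cup.\<close>

definition last_run :: "nat \<Rightarrow> nat \<Rightarrow> nat \<Rightarrow> vertex set set \<Rightarrow> bool" where
  "last_run n i j E \<longleftrightarrow>
     (\<forall>k. Suc i < k \<longrightarrow> k \<le> n \<longrightarrow> {(0, k), (1, k)} \<in> E) \<and>
     (0 < i \<longrightarrow> {(0, Suc i), (1, Suc i)} \<notin> E) \<and>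
     (0 < j \<longrightarrow> {(1, j), (1, Suc j)} \<in> E) \<and>
     (\<forall>k>j. {(1, k), (1, Suc k)} \<notin> E)"

lemma last_run_id: "last_run n 0 0 (id_flat n)"
  by (auto simp: last_run_def id_flat_def doubleton_eq_iff)

lemma last_run_strand: "last_run n i j E \<Longrightarrow> Suc i < k \<Longrightarrow> k \<le> n \<Longrightarrow> {(0, k), (1, k)} \<in> E"
  by (simp add: last_run_def)

text \<open>As \<open>i' < i\<close> and \<open>j' < j\<close>, all strands of \<open>E\<close>
  beyond \<open>i\<close> are vertical and \<open>E\<close> has no cup at \<open>j\<close> or later.
  A forbidden pair of the product either clashes with the cup at \<open>j\<close> or with a vertical
  strand, or pulls back along \<open>run_shift\<close> to such a cup of \<open>E\<close>.\<close>

lemma last_run_flat_word_run: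
  assumes tangle: "\<And>m. j \<le> m \<Longrightarrow> flat_word n E (run i m) \<in> flat_tangles n"
    and E: "last_run n i' j' E"
    and ij: "i' < i" "j' < j" "j \<le> i" "i < n"
  shows "last_run n i j (flat_word n E (run i j))"
proof -
  let ?R = "flat_word n E (run i j)"
  have tE: "E \<in> flat_tangles n" using tangle[of "Suc i"] ij by (simp add: run_def)
  have strand: "{(0, k), (1, k)} \<in> E" if "i < k" "k \<le> n" for k
    using E that ij by (simp add: last_run_def)
  have nocup: "{(1, k), (1, Suc k)} \<notin> E" if "j \<le> k" for k
    using E that ij by (simp add: last_run_def)
  have R: "?R \<in> flat_tangles n" using tangle by simp
  have cup: "{(1, j), (1, Suc j)} \<in> ?R" using flat_word_run_cup ij by simp
  have strand_i: "{(0, Suc i), (1, Suc i)} \<in> E" using strand ij by simp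
  have shift: "{run_shift i j p, run_shift i j q} \<in> ?R"
    if "{p, q} \<in> E" "{p, q} \<noteq> {(0, Suc i), (1, Suc i)}" for p q
    using flat_word_run[OF tangle strand_i that ij(3)] .
  have uniq: "x = run_shift i j q" if "{p, q} \<in> E" "p \<notin> {(0, Suc i), (1, Suc i)}" "{run_shift i j p, x} \<in> ?R" for p q x
    using flat_tangle_partner_unique[OF R that(3)] shift[OF that(1)] that(2) by blast
  have partner: "\<exists>q. {p, q} \<in> E \<and> q \<noteq> (1, Suc i)"
    if p: "p \<in> vertices n" "p \<notin> {(0, Suc i), (1, Suc i)}" for p
  proof -
    obtain q where q: "{p, q} \<in> E" using flat_tangle_partner_exists[OF tE p(1)] .
    then have "{p, q} \<inter> {(0, Suc i), (1, Suc i)} = {}"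
      using p(2) by (intro flat_tangle_pairs_disjoint[OF tE q strand_i]) auto
    then have "q \<noteq> (1, Suc i)" by auto
    then show ?thesis using q by blast
  qed
  have vert: "{(0, k), (1, k)} \<in> ?R" if "Suc i < k" "k \<le> n" for k
    using shift[OF strand[of k]] that by (simp add: run_shift_def doubleton_eq_iff)
  \<comment> \<open>\<open>(0, Suc i)\<close> is the image of \<open>(1, i)\<close>, and only
    \<open>(1, i - 1)\<close> can move to \<open>(1, Suc i)\<close>; a vertical strand here would
    come from a cup of \<open>E\<close> at \<open>i - 1\<close>.\<close>
  have "{(0, Suc i), (1, Suc i)} \<notin> ?R"
  proof
    assume a: "{(0, Suc i), (1, Suc i)} \<in> ?R"
    have "(1, i) \<in> vertices n" using ij by (simp add: vertices_def)
    then obtain q where q: "{(1, i), q} \<in> E" "q \<noteq> (1, Suc i)" using partner[of "(1, i)"] by auto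
    have "(1, Suc i) = run_shift i j q"
      using uniq[OF q(1), of "(1, Suc i)"] a by (simp add: run_shift_def)
    then have "q = (1, i - 1)" "j < i"
      using q(2) by (cases q; auto simp: run_shift_def split: if_splits)+
    then show False using nocup[of "i - 1"] q(1) ij by (simp add: insert_commute)
  qed
  \<comment> \<open>For \<open>k = Suc j\<close> the cup would share a vertex with the one at
    \<open>j\<close>. For larger \<open>k\<close> up to \<open>i\<close> it would come from a cup of
    \<open>E\<close> at \<open>k - 2\<close>; beyond \<open>i\<close> its end
    \<open>(1, Suc k)\<close> lies on a vertical strand.\<close>
  moreover have "{(1, k), (1, Suc k)} \<notin> ?R" if "j < k" for k
  proof
    assume a: "{(1, k), (1, Suc k)} \<in> ?R"
    have "{(1, j), (1, Suc j)} \<noteq> {(1, k), (1, Suc k)}" using that by (auto simp: doubleton_eq_iff)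
    then have k: "Suc j < k"
      using flat_tangle_pairs_disjoint[OF R cup a] that by (cases "k = Suc j") auto
    have kn: "Suc k \<le> n" using flat_tangle_pair(3)[OF R a] by (simp add: vertices_def)
    show False
    proof (cases "k \<le> i")
      case True
      obtain m where m: "k = m + 2" "j \<le> m"
        using k by (intro that[of "k - 2"]) auto
      have "(1, Suc m) \<in> vertices n" using m True ij by (simp add: vertices_def)
      then obtain q where q: "{(1, Suc m), q} \<in> E" "q \<noteq> (1, Suc i)"
        using partner[of "(1, Suc m)"] m True by auto
      have sh: "run_shift i j (1, Suc m) = (1, Suc k)" using m True by (simp add: run_shift_def)
      have "{(1, Suc k), (1, k)} \<in> ?R" using a by (simp add: insert_commute)
      then have "(1, k) = run_shift i j q"
        using uniq[OF q(1), of "(1, k)"] m True unfolding sh by simp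
      then have "q = (1, m)"
        using m True by (cases q) (auto simp: run_shift_def split: if_splits)
      then show False using nocup[OF m(2)] q(1) by (simp add: insert_commute)
    next
      case False
      then have "{(1, Suc k), (0, Suc k)} \<in> ?R" "{(1, Suc k), (1, k)} \<in> ?R"
        using vert[of "Suc k"] kn a by (simp_all add: insert_commute)
      then have "(0 :: nat, Suc k) = (1, k)" by (rule flat_tangle_partner_unique[OF R])
      then show False by simp
    qed
  qed
  ultimately show ?thesis using vert cup by (auto simp: last_run_def)
qed

section \<open>Jones words are determined by their tangles\<close>

lemma last_run_unique:
  assumes "last_run n i j E" "last_run n i' j' E" "i < n" "i' < n"
  shows "i = i'" "j = j'"
proof -
  show "i = i'" using assms by (cases i i' rule: linorder_cases) (auto simp: last_run_def)
  show "j = j'" using assms by (cases j j' rule: linorder_cases) (auto simp: last_run_def)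
qed

lemma last_run_jones:
  assumes "jones i j w" "i < n"
    and tangle: "\<And>w. set w \<subseteq> {1..<n} \<Longrightarrow> flat_word n (id_flat n) w \<in> flat_tangles n"
  shows "last_run n i j (flat_word n (id_flat n) w)"
  using assms(1,2)
proof (induction rule: jones.induct)
  case Nil
  then show ?case by (simp add: last_run_id)
next
  case (append_run i' j' u i j)
  have "flat_word n (flat_word n (id_flat n) u) (run i m) \<in> flat_tangles n" if "j \<le> m" for m
    using tangle[of "u @ run i m"] jones_set[OF append_run.hyps(1)] append_run that by fastforce
  then show ?case
    using last_run_flat_word_run[of j n "flat_word n (id_flat n) u" i i' j'] append_run by simp
qed

lemma flat_word_jones_inj:
  assumes "jones i j w" "jones i' j' w'" "i < n" "i' < n"
    and tangle: "\<And>w. set w \<subseteq> {1..<n} \<Longrightarrow> flat_word n (id_flat n) w \<in> flat_tangles n"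
    and "flat_word n (id_flat n) w = flat_word n (id_flat n) w'"
  shows "w = w'"
  using assms(1-4,6)
proof (induction arbitrary: i' j' w' rule: jones.induct)
  case Nil
  then have "last_run n 0 0 (id_flat n)" "last_run n i' j' (id_flat n)"
    using last_run_id last_run_jones[OF Nil(1) _ tangle] by auto
  then have "i' = 0" using last_run_unique Nil by blast
  with Nil(1) have "jones 0 j' w'" by simp
  then show ?case by cases auto
next
  case (append_run i1 j1 u i j)
  let ?T = "flat_word n (id_flat n)"
  have "jones i j (u @ run i j)" using append_run by (intro jones.append_run)
  then have "last_run n i j (?T (u @ run i j))" "last_run n i' j' (?T (u @ run i j))"
    using last_run_jones[OF _ _ tangle] append_run by metis+
  then have ij: "i' = i" "j' = j" using last_run_unique append_run.prems by metis+
  show ?case using append_run.prems(1)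
  proof cases
    case Nil
    then show ?thesis using append_run ij by simp
  next
    case step: (append_run i2 j2 u')
    have t: "?T (v @ run i m) \<in> flat_tangles n" if "v = u \<or> v = u'" "j \<le> m" for v m
    proof -
      have "set v \<subseteq> {1..<i}" "0 < j"
        using that(1) jones_set[OF append_run.hyps(1)] jones_set[OF step(2)] append_run.hyps step ij
        by fastforce+
      then show ?thesis using that(2) append_run.prems by (intro tangle) auto
    qed
    \<comment> \<open>The word before the run has its top below \<open>i\<close>, so strand
      \<open>Suc i\<close> is still vertical, as undoing the run requires.\<close>
    have s: "{(0, Suc i), (1, Suc i)} \<in> ?T v" if "jones i0 j0 v" "i0 < i" for i0 j0 v
      using last_run_strand[OF last_run_jones[OF that(1) _ tangle]] that(2) append_run.prems by simp
    have "?T u = ?T u'"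
    proof (rule flat_word_run_inj)
      show "flat_word n (?T u) (run i m) \<in> flat_tangles n"
        "flat_word n (?T u') (run i m) \<in> flat_tangles n" if "j \<le> m" for m
        using t[of u m] t[of u' m] that by simp_all
      show "{(0, Suc i), (1, Suc i)} \<in> ?T u" "{(0, Suc i), (1, Suc i)} \<in> ?T u'"
        using s append_run.hyps(1,2) step(2,3) ij by blast+
      show "flat_word n (?T u) (run i j) = flat_word n (?T u') (run i j)"
        using append_run.prems(4) step(1) ij by simp
    qed fact
    then have "u = u'"
      using append_run.IH[OF step(2)] append_run.prems append_run.hyps step ij by simp
    then show ?thesis using step ij by simp
  qed
qed

section \<open>Reduction modulo the Temperley--Lieb ideal\<close>

lemma single_in_free_algebra:
  "set w \<subseteq> {1..<n} \<Longrightarrow> Poly_Mapping.single w c \<in> carrier (free_algebra n)"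
  by (force simp: free_algebra_def)

lemma free_algebra_closed:
  assumes "x \<in> carrier (free_algebra n)" "y \<in> carrier (free_algebra n)"
  shows "x + y \<in> carrier (free_algebra n)" "x * y \<in> carrier (free_algebra n)"
    "x - y \<in> carrier (free_algebra n)"
proof -
  interpret ring "free_algebra n" by (rule ring_free_algebra)
  show "x + y \<in> carrier (free_algebra n)" "x * y \<in> carrier (free_algebra n)"
    using a_closed[OF assms] m_closed[OF assms] by (simp_all add: free_algebra_def)
  show "x - y \<in> carrier (free_algebra n)"
    using assms keys_diff[of x y] by (auto simp: free_algebra_def)
qed

lemma free_algebra_a_minus:
  assumes "x \<in> carrier (free_algebra n)" "y \<in> carrier (free_algebra n)"
  shows "x \<ominus>\<^bsub>free_algebra n\<^esub> y = x - y"
proof -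
  interpret ring "free_algebra n" by (rule ring_free_algebra)
  have "- y \<in> carrier (free_algebra n)" using assms by (simp add: free_algebra_def)
  then have "\<ominus>\<^bsub>free_algebra n\<^esub> y = - y"
    using assms by (intro minus_equality) (simp_all add: free_algebra_def)
  then show ?thesis by (simp add: a_minus_def) (simp add: free_algebra_def)
qed

lemma TL_relators_subset: "TL_relators n \<subseteq> carrier (free_algebra n)"
proof -
  have "free_gen i \<in> carrier (free_algebra n)" if "i \<in> {1..n-1}" for i
    using that by (auto simp: free_gen_def free_algebra_def)
  moreover have "free_scalar c \<in> carrier (free_algebra n)" for c
    by (auto simp: free_scalar_def free_algebra_def)
  ultimately show ?thesis
    unfolding TL_relators_def by (auto intro!: free_algebra_closed)
qed

lemma ideal_TL_ideal: "ideal (TL_ideal n) (free_algebra n)"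
  unfolding TL_ideal_def by (rule ring.genideal_ideal[OF ring_free_algebra TL_relators_subset])

lemma TL_ideal_subset: "x \<in> TL_ideal n \<Longrightarrow> x \<in> carrier (free_algebra n)"
  using ideal.Icarr[OF ideal_TL_ideal] .

lemma TL_ideal_add: "x \<in> TL_ideal n \<Longrightarrow> y \<in> TL_ideal n \<Longrightarrow> x + y \<in> TL_ideal n"
  using additive_subgroup.a_closed[OF ideal.axioms(1)[OF ideal_TL_ideal], of x n y]
  by (simp add: free_algebra_def)

lemma TL_ideal_zero: "0 \<in> TL_ideal n"
  using additive_subgroup.zero_closed[OF ideal.axioms(1)[OF ideal_TL_ideal], of n]
  by (simp add: free_algebra_def)

lemma TL_ideal_sum: "(\<And>a. a \<in> A \<Longrightarrow> h a \<in> TL_ideal n) \<Longrightarrow> sum h A \<in> TL_ideal n"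
  by (induction A rule: infinite_finite_induct) (auto simp: TL_ideal_zero intro: TL_ideal_add)

lemma TL_ideal_mult:
  assumes "x \<in> TL_ideal n" "y \<in> carrier (free_algebra n)"
  shows "x * y \<in> TL_ideal n" "y * x \<in> TL_ideal n"
  using ideal.I_l_closed[OF ideal_TL_ideal assms] ideal.I_r_closed[OF ideal_TL_ideal assms]
  by (simp_all add: free_algebra_def)

lemma TL_relators_in_ideal: "x \<in> TL_relators n \<Longrightarrow> x \<in> TL_ideal n"
  unfolding TL_ideal_def using ring.genideal_self[OF ring_free_algebra TL_relators_subset] by blast

text \<open>The factor z that \<open>square\<close> drops reappears here: the exponent is 1 for a
  square and 0 otherwise. The words around the relator are absorbed by the two-sided ideal.\<close>

lemma tl_step_sound:
  assumes "tl_step u v" "set u \<subseteq> {1..<n}"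
  shows "\<exists>a. Poly_Mapping.single u 1 - Poly_Mapping.single v (z_TL ^ a) \<in> TL_ideal n"
proof -
  let ?s = "\<lambda>w. Poly_Mapping.single w (1 :: int poly)"
  have context_in: "?s p * x * ?s q \<in> TL_ideal n"
    if "x \<in> TL_relators n" "set p \<subseteq> {1..<n}" "set q \<subseteq> {1..<n}" for x p q
    by (rule TL_ideal_mult(1)[OF TL_ideal_mult(2)[OF TL_relators_in_ideal[OF that(1)]]])
      (rule single_in_free_algebra, fact)+
  show ?thesis using assms(1)
  proof cases
    case (square p i q)
    then have "i \<in> {1..n-1}" "set p \<subseteq> {1..<n}" "set q \<subseteq> {1..<n}" using assms(2) by auto
    then have "?s p * (free_gen i * free_gen i - free_scalar z_TL * free_gen i) * ?s q \<in> TL_ideal n"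
      by (intro context_in) (unfold TL_relators_def, blast)
    then have "?s u - Poly_Mapping.single v (z_TL ^ 1) \<in> TL_ideal n"
      by (simp add: square free_gen_def free_scalar_def mult_single plus_list_def
          left_diff_distrib right_diff_distrib)
    then show ?thesis by blast
  next
    case (commute i j p q)
    then have "i \<in> {1..n-1}" "j \<in> {1..n-1}" "\<bar>int i - int j\<bar> \<ge> 2"
      "set p \<subseteq> {1..<n}" "set q \<subseteq> {1..<n}" using assms(2) by auto
    then have "?s p * (free_gen i * free_gen j - free_gen j * free_gen i) * ?s q \<in> TL_ideal n"
      by (intro context_in) (unfold TL_relators_def, blast)
    then have "?s u - Poly_Mapping.single v (z_TL ^ 0) \<in> TL_ideal n"
      by (simp add: commute free_gen_def mult_single plus_list_def
          left_diff_distrib right_diff_distrib)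
    then show ?thesis by blast
  next
    case (contract j i p q)
    then have "i \<in> {1..n-1}" "j \<in> {1..n-1}" "\<bar>int i - int j\<bar> = 1"
      "set p \<subseteq> {1..<n}" "set q \<subseteq> {1..<n}" using assms(2) by auto
    then have "?s p * (free_gen i * free_gen j * free_gen i - free_gen i) * ?s q \<in> TL_ideal n"
      by (intro context_in) (unfold TL_relators_def, blast)
    then have "?s u - Poly_Mapping.single v (z_TL ^ 0) \<in> TL_ideal n"
      by (simp add: contract free_gen_def mult_single plus_list_def
          left_diff_distrib right_diff_distrib)
    then show ?thesis by blast
  qed
qed

lemma tl_reduces_sound:
  assumes "u \<leadsto> v" "set u \<subseteq> {1..<n}"
  shows "\<exists>a. Poly_Mapping.single u 1 - Poly_Mapping.single v (z_TL ^ a) \<in> TL_ideal n"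
  using assms(1)
proof (induction rule: rtranclp_induct)
  case base
  show ?case using TL_ideal_zero by (intro exI[of _ 0]) simp
next
  case (step v w)
  then obtain a where a: "Poly_Mapping.single u 1 - Poly_Mapping.single v (z_TL ^ a) \<in> TL_ideal n"
    by blast
  have "set v \<subseteq> {1..<n}" using tl_reduces_set[OF step.hyps(1)] assms(2) by blast
  then obtain b where "Poly_Mapping.single v 1 - Poly_Mapping.single w (z_TL ^ b) \<in> TL_ideal n"
    using tl_step_sound[OF step.hyps(2)] by blast
  \<comment> \<open>Scaling the second difference by the power already collected makes the sum
    telescope.\<close>
  then have "Poly_Mapping.single [] (z_TL ^ a) *
      (Poly_Mapping.single v 1 - Poly_Mapping.single w (z_TL ^ b)) \<in> TL_ideal n"
    by (rule TL_ideal_mult(2)[OF _ single_in_free_algebra]) simp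
  then have "Poly_Mapping.single v (z_TL ^ a) - Poly_Mapping.single w (z_TL ^ (a + b)) \<in> TL_ideal n"
    by (simp add: right_diff_distrib mult_single plus_list_def power_add)
  from TL_ideal_add[OF a this] show ?case by auto
qed

section \<open>Products of single arrow tangles and their coefficients\<close>

lemma ATL_mult_single:
  "ATL_mult (Poly_Mapping.single F c) (Poly_Mapping.single G d) =
     Poly_Mapping.single (arrow_star F G) (c * d * loop_factor F G)"
  by (cases "c = 0"; cases "d = 0") (simp_all add: ATL_mult_def)

lemma fst_arrow_star: "fst (arrow_star F G) = flat_star (fst F) (fst G)"
  by (simp add: arrow_star_def split: prod.split)

text \<open>Each factor is a variable; the product over an infinite set is 1 by convention, again a
  monomial.\<close>

lemma loop_factor_monomial: "\<exists>\<mu>. loop_factor F G = Poly_Mapping.single \<mu> 1"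
proof -
  have "\<exists>\<mu>. (\<Prod>x\<in>A. z_ATL (h x)) = Poly_Mapping.single \<mu> 1" for A and h :: "step list \<Rightarrow> nat"
    by (induction A rule: infinite_finite_induct)
      (auto simp: z_ATL_def mult_single intro: exI[of _ 0])
  then show ?thesis by (simp add: loop_factor_def split: prod.split)
qed

text \<open>A cycle has positive even length, so its second step joins two top vertices of the
  second factor; the identity has no such pair.\<close>

lemma loop_factor_id: "loop_factor F (id_arrow n) = 1"
proof -
  have "cycles E (id_flat n) = {}" for E
  proof -
    have False if g: "\<gamma> \<in> cycles E (id_flat n)" for \<gamma>
    proof -
      have "\<gamma> \<noteq> []" "even (length \<gamma>)" using g by (auto simp: cycles_def)
      then have l: "1 < length \<gamma>" by (cases \<gamma>; cases "tl \<gamma>") auto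
      define s where "s = \<gamma> ! 1"
      have "is_Second s \<and> fst (src s) = 0 \<and> fst (tgt s) = 0"
        using g l unfolding cycles_def s_def by fastforce
      moreover have "s \<in> steps E (id_flat n)"
        using g l nth_mem[OF l] unfolding cycles_def s_def by blast
      ultimately have "{src s, tgt s} \<in> id_flat n" "fst (src s) = 0" "fst (tgt s) = 0"
        by (cases s; simp add: steps_def pair_of_def)+
      then show False by (auto simp: id_flat_def doubleton_eq_iff)
    qed
    then show ?thesis by blast
  qed
  then show ?thesis by (simp add: loop_factor_def id_arrow_def split: prod.split)
qed

text \<open>Summing over all labellings of \<open>E\<close> gives an additive functional that
  forgets the labels, so it can be evaluated on tangles of which only the underlying pairs are
  known.\<close>

definition tangle_coeff :: "vertex set set \<Rightarrow> (nat \<Rightarrow>\<^sub>0 nat) \<Rightarrow> arrow_alg \<Rightarrow> int" where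
  "tangle_coeff E \<mu> x = (\<Sum>F\<in>{F \<in> Poly_Mapping.keys x. fst F = E}.
     Poly_Mapping.lookup (Poly_Mapping.lookup x F) \<mu>)"

lemma tangle_coeff_superset:
  assumes "finite S" "Poly_Mapping.keys x \<subseteq> S"
  shows "tangle_coeff E \<mu> x =
    (\<Sum>F\<in>{F \<in> S. fst F = E}. Poly_Mapping.lookup (Poly_Mapping.lookup x F) \<mu>)"
  unfolding tangle_coeff_def using assms
  by (intro sum.mono_neutral_left) (auto simp: in_keys_iff)

lemma tangle_coeff_add: "tangle_coeff E \<mu> (x + y) = tangle_coeff E \<mu> x + tangle_coeff E \<mu> y"
proof -
  let ?S = "Poly_Mapping.keys x \<union> Poly_Mapping.keys y"
  have "finite ?S" "Poly_Mapping.keys (x + y) \<subseteq> ?S" by (simp_all add: keys_add)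
  then show ?thesis
    by (simp add: tangle_coeff_superset[of ?S] lookup_add sum.distrib)
qed

lemma tangle_coeff_single:
  "tangle_coeff E \<mu> (Poly_Mapping.single F c) = (if fst F = E then Poly_Mapping.lookup c \<mu> else 0)"
proof -
  have "{G \<in> {F}. fst G = E} = (if fst F = E then {F} else {})" by auto
  then show ?thesis using tangle_coeff_superset[of "{F}" "Poly_Mapping.single F c" E \<mu>] by simp
qed

lemma additive_int_mult:
  fixes g :: "int \<Rightarrow> int"
  assumes add: "\<And>a b. g (a + b) = g a + g b"
  shows "g a = a * g 1"
proof (induction a rule: int_induct[where k = 0])
  case base
  show ?case using add[of 0 0] by simp
next
  case (step1 i)
  then show ?case using add[of i 1] by (simp add: algebra_simps)
next
  case (step2 i)
  then show ?case using add[of "i - 1" 1] by (simp add: algebra_simps)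
qed

lemma poly_mapping_eq_sum_single:
  "x = (\<Sum>w\<in>Poly_Mapping.keys x. Poly_Mapping.single w (Poly_Mapping.lookup x w))"
  by (rule poly_mapping_eqI) (auto simp: lookup_sum lookup_single when_def in_keys_iff)

section \<open>Independence of the images of Jones words\<close>

lemma single_one_nonzero: "Poly_Mapping.single \<mu> (1 :: 'a :: zero_neq_one) \<noteq> 0"
  by (metis lookup_single_eq lookup_zero zero_neq_one)

text \<open>\<open>\<psi>\<close> models \<iota> after the projection from the free algebra. With
  representatives in place of cosets, injectivity of \<iota> becomes the inclusion of the kernel of
  \<open>\<psi>\<close> in the ideal.\<close>

locale tl_representation =
  fixes n :: nat and \<psi> :: "free_alg \<Rightarrow> arrow_alg"
  assumes hom: "\<psi> \<in> ring_hom (free_algebra n) (ATL n)"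
    and scalar: "\<psi> (free_scalar z_TL) = ATL_scalar n (z_ATL 0)"
    and gen: "i \<in> {1..n-1} \<Longrightarrow> \<psi> (free_gen i) = ATL_gen n i"
    and ideal_zero: "x \<in> TL_ideal n \<Longrightarrow> \<psi> x = 0"
begin

abbreviation word_tangle :: "nat list \<Rightarrow> vertex set set" where
  "word_tangle \<equiv> flat_word n (id_flat n)"

lemma psi_add:
  "x \<in> carrier (free_algebra n) \<Longrightarrow> y \<in> carrier (free_algebra n) \<Longrightarrow> \<psi> (x + y) = \<psi> x + \<psi> y"
  using ring_hom_add[OF hom, of x y] by (simp add: free_algebra_def ATL_def)

lemma psi_mult:
  "x \<in> carrier (free_algebra n) \<Longrightarrow> y \<in> carrier (free_algebra n) \<Longrightarrow>
     \<psi> (x * y) = ATL_mult (\<psi> x) (\<psi> y)"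
  using ring_hom_mult[OF hom, of x y] by (simp add: free_algebra_def ATL_def)

lemma psi_one: "\<psi> 1 = Poly_Mapping.single (id_arrow n) 1"
  using ring_hom_one[OF hom] by (simp add: free_algebra_def ATL_def)

lemma psi_zero: "\<psi> 0 = 0"
  by (rule ideal_zero[OF TL_ideal_zero])

lemma psi_keys: "x \<in> carrier (free_algebra n) \<Longrightarrow> Poly_Mapping.keys (\<psi> x) \<subseteq> arrow_tangles n"
  using ring_hom_closed[OF hom, of x] by (simp add: ATL_def)

lemma psi_word:
  assumes "set w \<subseteq> {1..<n}"
  shows "\<exists>F \<mu>. \<psi> (Poly_Mapping.single w 1) = Poly_Mapping.single F (Poly_Mapping.single \<mu> 1)
    \<and> fst F = word_tangle w"
  using assms
proof (induction w rule: rev_induct)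
  case Nil
  have "\<psi> (Poly_Mapping.single [] 1) = Poly_Mapping.single (id_arrow n) (Poly_Mapping.single 0 1)"
    using psi_one by (simp flip: single_one add: zero_list_def)
  then show ?case
    by (intro exI[of _ "id_arrow n"] exI[of _ 0] conjI) (simp_all add: id_arrow_def)
next
  case (snoc i w)
  then obtain F \<mu> where F: "\<psi> (Poly_Mapping.single w 1) = Poly_Mapping.single F (Poly_Mapping.single \<mu> 1)"
    "fst F = word_tangle w" by auto
  obtain \<nu> where \<nu>: "loop_factor F (hook_arrow n i) = Poly_Mapping.single \<nu> 1"
    using loop_factor_monomial by blast
  have "Poly_Mapping.single (w @ [i]) 1 = Poly_Mapping.single w 1 * free_gen i"
    by (simp add: free_gen_def mult_single plus_list_def)
  also have "\<psi> \<dots> = ATL_mult (\<psi> (Poly_Mapping.single w 1)) (\<psi> (free_gen i))"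
    using snoc.prems by (intro psi_mult) (simp_all add: single_in_free_algebra free_gen_def)
  also have "\<dots> = Poly_Mapping.single (arrow_star F (hook_arrow n i)) (Poly_Mapping.single (\<mu> + \<nu>) 1)"
  proof -
    have "i \<in> {1..n-1}" using snoc.prems by auto
    then show ?thesis by (simp add: gen F \<nu> ATL_gen_def ATL_mult_single mult_single)
  qed
  finally show ?case
    by (intro exI conjI) (auto simp: fst_arrow_star F hook_arrow_def)
qed

lemma tangle_of_psi:
  assumes "x \<in> carrier (free_algebra n)" "\<psi> x = Poly_Mapping.single F c" "c \<noteq> 0"
  shows "fst F \<in> flat_tangles n"
  using psi_keys[OF assms(1)] assms(2,3) by (auto simp: arrow_tangles_def)

text \<open>That the product of flat tangles is again a flat tangle comes for free, because \<open>\<psi>\<close> takes its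
  values in the carrier of the arrow algebra.\<close>

lemma word_tangle_flat: "set w \<subseteq> {1..<n} \<Longrightarrow> word_tangle w \<in> flat_tangles n"
  using psi_word[of w] tangle_of_psi[OF single_in_free_algebra] single_one_nonzero by metis

text \<open>\<mu> is chosen before \<open>k\<close>, so that distinct powers of z yield distinct
  monomials. \<open>F\<close> may vary with \<open>k\<close>: only the flat tangle is tracked
  through the multiplication by the scalar, and \<open>flat_star_id\<close> keeps it fixed.\<close>

lemma psi_word_monom:
  assumes "set w \<subseteq> {1..<n}"
  shows "\<exists>\<mu>. \<forall>k. \<exists>F. \<psi> (Poly_Mapping.single w (monom 1 k)) =
      Poly_Mapping.single F (Poly_Mapping.single (\<mu> + Poly_Mapping.single 0 k) 1)
    \<and> fst F = word_tangle w"
proof -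
  obtain \<mu> F0 where F0: "\<psi> (Poly_Mapping.single w 1) = Poly_Mapping.single F0 (Poly_Mapping.single \<mu> 1)"
    "fst F0 = word_tangle w" using psi_word[OF assms] by blast
  have "\<exists>F. \<psi> (Poly_Mapping.single w (monom 1 k)) =
      Poly_Mapping.single F (Poly_Mapping.single (\<mu> + Poly_Mapping.single 0 k) 1)
    \<and> fst F = word_tangle w" for k
  proof (induction k)
    case 0
    show ?case using F0 by (intro exI[of _ F0]) simp
  next
    case (Suc k)
    then obtain F where F: "\<psi> (Poly_Mapping.single w (monom 1 k)) =
        Poly_Mapping.single F (Poly_Mapping.single (\<mu> + Poly_Mapping.single 0 k) 1)"
      "fst F = word_tangle w" by blast
    let ?x = "Poly_Mapping.single w (monom 1 (Suc k)) :: free_alg"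
    have "monom 1 (Suc k) = monom 1 k * z_TL"
      by (simp add: z_TL_def monom_altdef)
    then have "?x = Poly_Mapping.single w (monom 1 k) * free_scalar z_TL"
      by (simp add: free_scalar_def mult_single plus_list_def)
    also have "\<psi> \<dots> = ATL_mult (\<psi> (Poly_Mapping.single w (monom 1 k))) (\<psi> (free_scalar z_TL))"
      using assms by (intro psi_mult) (simp_all add: single_in_free_algebra free_scalar_def)
    also have "\<dots> = Poly_Mapping.single (arrow_star F (id_arrow n))
        (Poly_Mapping.single (\<mu> + Poly_Mapping.single 0 k + Poly_Mapping.single 0 1) 1)"
      by (simp add: F scalar ATL_scalar_def ATL_mult_single loop_factor_id z_ATL_def mult_single)
    also have "\<mu> + Poly_Mapping.single 0 k + Poly_Mapping.single 0 1 =
        \<mu> + Poly_Mapping.single 0 (Suc k)"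
      by (simp add: add.assoc flip: single_add)
    finally have x: "\<psi> ?x = Poly_Mapping.single (arrow_star F (id_arrow n))
        (Poly_Mapping.single (\<mu> + Poly_Mapping.single 0 (Suc k)) 1)" .
    have "fst (arrow_star F (id_arrow n)) = flat_star (word_tangle w) (id_flat n)"
      by (simp add: fst_arrow_star F id_arrow_def)
    moreover have "fst (arrow_star F (id_arrow n)) \<in> flat_tangles n"
      using tangle_of_psi[OF single_in_free_algebra[OF assms] x single_one_nonzero] .
    ultimately have "fst (arrow_star F (id_arrow n)) = word_tangle w"
      using flat_star_id[OF word_tangle_flat[OF assms]] by simp
    then show ?case using x by blast
  qed
  then show ?thesis by blast
qed

lemma tangle_coeff_psi_sum:
  assumes "finite A" "\<And>a. a \<in> A \<Longrightarrow> h a \<in> carrier (free_algebra n)"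
  shows "(\<Sum>a\<in>A. h a) \<in> carrier (free_algebra n) \<and>
    tangle_coeff E \<mu> (\<psi> (\<Sum>a\<in>A. h a)) = (\<Sum>a\<in>A. tangle_coeff E \<mu> (\<psi> (h a)))"
  using assms
proof (induction A rule: finite_induct)
  case empty
  show ?case by (simp add: psi_zero tangle_coeff_def) (simp add: free_algebra_def)
next
  case (insert a A)
  then show ?case by (simp add: psi_add tangle_coeff_add free_algebra_closed)
qed

definition jones_words :: "nat list set" where
  "jones_words = {w. set w \<subseteq> {1..<n} \<and> (\<exists>i j. jones i j w)}"

lemma word_tangle_inj: "inj_on word_tangle jones_words"
proof (rule inj_onI)
  fix v w assume "v \<in> jones_words" "w \<in> jones_words" and eq: "word_tangle v = word_tangle w"
  then obtain i j i' j' where v: "jones i j v" "set v \<subseteq> {1..<n}" and w: "jones i' j' w" "set w \<subseteq> {1..<n}"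
    unfolding jones_words_def by blast
  show "v = w"
  \<comment> \<open>For \<open>n = 0\<close> the bound \<open>i < n\<close> fails even for the empty
    word, the only word there is.\<close>
  proof (cases "n = 0")
    case True
    then show ?thesis using v w by simp
  next
    case False
    then have "i < n" "i' < n"
      using jones_top_mem[OF v(1)] jones_top_mem[OF w(1)] v(2) w(2) by (cases i; cases i'; force)+
    then show ?thesis using flat_word_jones_inj[OF v(1) w(1) _ _ word_tangle_flat eq] by blast
  qed
qed

text \<open>Linear independence of the images of the Jones words: the coefficient of \<open>z\<^sup>k w\<close> is recovered
  from the terms of \<open>\<psi> y\<close> supported on the flat tangle of \<open>w\<close>, whatever their labels are.\<close>

lemma psi_inj_jones:
  assumes keys: "Poly_Mapping.keys y \<subseteq> jones_words" and zero: "\<psi> y = 0"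
  shows "y = 0"
proof (rule poly_mapping_eqI)
  fix w
  have word: "set v \<subseteq> {1..<n}" if "v \<in> jones_words" for v
    using that by (simp add: jones_words_def)
  obtain \<mu> where \<mu>: "\<And>v k. v \<in> jones_words \<Longrightarrow> \<exists>F. \<psi> (Poly_Mapping.single v (monom 1 k)) =
      Poly_Mapping.single F (Poly_Mapping.single (\<mu> v + Poly_Mapping.single 0 k) 1)
    \<and> fst F = word_tangle v"
    using psi_word_monom[OF word] by metis
  show "Poly_Mapping.lookup y w = Poly_Mapping.lookup 0 w"
  proof (cases "w \<in> jones_words")
    case True
    have "coeff (Poly_Mapping.lookup y w) k = 0" for k
    proof -
      let ?c = "\<lambda>x. tangle_coeff (word_tangle w) (\<mu> w + Poly_Mapping.single 0 k) (\<psi> x)"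
      \<comment> \<open>Distinct Jones words have distinct tangles, which leaves
        \<open>v = w\<close>; the common summand \<open>\<mu> w\<close> then reduces the comparison
        of monomials to the exponents of z_0.\<close>
      have monom1: "?c (Poly_Mapping.single v (monom 1 l)) = (if v = w \<and> l = k then 1 else 0)"
        if v: "v \<in> jones_words" for v l
      proof -
        obtain F where F: "\<psi> (Poly_Mapping.single v (monom 1 l)) =
            Poly_Mapping.single F (Poly_Mapping.single (\<mu> v + Poly_Mapping.single 0 l) 1)"
          "fst F = word_tangle v" using \<mu>[OF v] by blast
        have "fst F = word_tangle w \<longleftrightarrow> v = w"
          using inj_on_eq_iff[OF word_tangle_inj v True] F(2) by simp
        moreover have "Poly_Mapping.single (0 :: nat) l = Poly_Mapping.single 0 k \<longleftrightarrow> l = k"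
          by (metis lookup_single_eq)
        ultimately show ?thesis by (auto simp: F tangle_coeff_single lookup_single when_def)
      qed
      \<comment> \<open>Additivity of \<open>\<psi>\<close> is enough to take out an integer
        coefficient.\<close>
      have monom: "?c (Poly_Mapping.single v (monom a l)) = (if v = w \<and> l = k then a else 0)"
        if v: "v \<in> jones_words" for v l a
      proof -
        have "?c (Poly_Mapping.single v (monom (a + b) l)) =
            ?c (Poly_Mapping.single v (monom a l)) + ?c (Poly_Mapping.single v (monom b l))" for a b
          using psi_add[OF single_in_free_algebra single_in_free_algebra, OF word[OF v] word[OF v]]
          by (simp add: tangle_coeff_add single_add flip: add_monom)
        from additive_int_mult[of "\<lambda>a. ?c (Poly_Mapping.single v (monom a l))", OF this, of a]
        show ?thesis unfolding monom1[OF v] by simp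
      qed
      have poly: "?c (Poly_Mapping.single v p) = (if v = w then coeff p k else 0)"
        if v: "v \<in> jones_words" for v p
      proof -
        have "Poly_Mapping.single v p = (\<Sum>l\<le>degree p. Poly_Mapping.single v (monom (coeff p l) l))"
          by (subst (1) poly_as_sum_of_monoms[of p, symmetric], rule poly_mapping_eqI)
            (simp add: lookup_sum lookup_single when_def)
        then have "?c (Poly_Mapping.single v p) =
            (\<Sum>l\<le>degree p. ?c (Poly_Mapping.single v (monom (coeff p l) l)))"
          using tangle_coeff_psi_sum[of "{..degree p}"] single_in_free_algebra[OF word[OF v]] by simp
        also have "\<dots> = (\<Sum>l\<le>degree p. if l = k then (if v = w then coeff p l else 0) else 0)"
          by (intro sum.cong) (auto simp: monom[OF v])
        also have "\<dots> = (if v = w then coeff p k else 0)"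
          by (auto simp: sum.delta coeff_eq_0)
        finally show ?thesis .
      qed
      have "?c y = (\<Sum>v\<in>Poly_Mapping.keys y. ?c (Poly_Mapping.single v (Poly_Mapping.lookup y v)))"
      proof -
        have "Poly_Mapping.single v c \<in> carrier (free_algebra n)" if "v \<in> Poly_Mapping.keys y" for v c
          using that keys by (intro single_in_free_algebra word) blast
        then show ?thesis
          using tangle_coeff_psi_sum[of "Poly_Mapping.keys y"
              "\<lambda>v. Poly_Mapping.single v (Poly_Mapping.lookup y v)"]
          by (simp flip: poly_mapping_eq_sum_single)
      qed
      also have "\<dots> = (\<Sum>v\<in>Poly_Mapping.keys y. if v = w then coeff (Poly_Mapping.lookup y v) k else 0)"
        using keys by (intro sum.cong) (auto simp: poly)
      also have "\<dots> = coeff (Poly_Mapping.lookup y w) k"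
        by (auto simp: sum.delta in_keys_iff)
      finally show ?thesis using zero by (simp add: tangle_coeff_def)
    qed
    then show ?thesis by (simp add: poly_eq_iff)
  next
    case False
    then show ?thesis using keys by (auto simp: in_keys_iff)
  qed
qed

text \<open>Modulo the ideal, \<open>x\<close> is a combination \<open>y\<close> of Jones words.
  Since \<open>\<psi>\<close> kills \<open>x - y\<close>, it also kills \<open>y\<close>, and
  independence gives \<open>y = 0\<close>.\<close>

lemma psi_kernel:
  assumes x: "x \<in> carrier (free_algebra n)" and zero: "\<psi> x = 0"
  shows "x \<in> TL_ideal n"
proof -
  have word: "set w \<subseteq> {1..<n}" if "w \<in> Poly_Mapping.keys x" for w
    using that x by (force simp: free_algebra_def)
  have "\<exists>v a. v \<in> jones_words \<and>
      Poly_Mapping.single w 1 - Poly_Mapping.single v (z_TL ^ a) \<in> TL_ideal n"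
    if w: "w \<in> Poly_Mapping.keys x" for w
  proof -
    have "0 \<notin> set w" using word[OF w] by auto
    then obtain i j v where v: "w \<leadsto> v" "jones i j v" using reduces_to_jones by blast
    then have "v \<in> jones_words"
      using tl_reduces_set[OF v(1)] word[OF w] by (auto simp: jones_words_def)
    then show ?thesis using tl_reduces_sound[OF v(1) word[OF w]] by blast
  qed
  then obtain N a where N: "\<And>w. w \<in> Poly_Mapping.keys x \<Longrightarrow> N w \<in> jones_words"
    and ideal: "\<And>w. w \<in> Poly_Mapping.keys x \<Longrightarrow>
      Poly_Mapping.single w 1 - Poly_Mapping.single (N w) (z_TL ^ a w) \<in> TL_ideal n"
    by metis
  define y where
    "y = (\<Sum>w\<in>Poly_Mapping.keys x. Poly_Mapping.single (N w) (Poly_Mapping.lookup x w * z_TL ^ a w))"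
  have "Poly_Mapping.keys y \<subseteq>
      (\<Union>w\<in>Poly_Mapping.keys x. Poly_Mapping.keys (Poly_Mapping.single (N w) (Poly_Mapping.lookup x w * z_TL ^ a w)))"
    unfolding y_def by (rule keys_sum)
  also have "\<dots> \<subseteq> jones_words" using N by (auto split: if_splits)
  finally have keys: "Poly_Mapping.keys y \<subseteq> jones_words" .
  \<comment> \<open>Each word contributes its coefficient times the difference between the word and
    its scaled normal form, which lies in the ideal.\<close>
  have "x - y = (\<Sum>w\<in>Poly_Mapping.keys x. Poly_Mapping.single [] (Poly_Mapping.lookup x w) *
      (Poly_Mapping.single w 1 - Poly_Mapping.single (N w) (z_TL ^ a w)))"
    unfolding y_def
    by (subst (1) poly_mapping_eq_sum_single[of x])
      (simp add: sum_subtractf right_diff_distrib mult_single plus_list_def)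
  also have "\<dots> \<in> TL_ideal n"
    using ideal by (intro TL_ideal_sum TL_ideal_mult(2) single_in_free_algebra) auto
  finally have diff: "x - y \<in> TL_ideal n" .
  have "y \<in> carrier (free_algebra n)"
    using free_algebra_closed(3)[OF x TL_ideal_subset[OF diff]] by simp
  then have "\<psi> x = \<psi> (x - y) + \<psi> y" using psi_add[OF TL_ideal_subset[OF diff], of y] by simp
  then have "\<psi> y = 0" using zero ideal_zero[OF diff] by simp
  then have "y = 0" using psi_inj_jones[OF keys] by simp
  then show ?thesis using diff by simp
qed

end

section \<open>Passage to the quotient\<close>

theorem proposition3p3:
  fixes n :: nat and \<iota> :: "free_alg set \<Rightarrow> arrow_alg"
  assumes "n \<ge> 2"
    and "\<iota> \<in> ring_hom (TL n) (ATL n)"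
    and "\<iota> (TL_scalar n z_TL) = ATL_scalar n (z_ATL 0)"
    and "\<And>i. i \<in> {1..n-1} \<Longrightarrow> \<iota> (TL_gen n i) = ATL_gen n i"
  shows "inj_on \<iota> (carrier (TL n))"
proof -
  let ?R = "free_algebra n" and ?I = "TL_ideal n"
  interpret R: ring ?R by (rule ring_free_algebra)
  interpret I: ideal ?I ?R by (rule ideal_TL_ideal)
  define \<psi> where "\<psi> = \<iota> \<circ> (+>\<^bsub>?R\<^esub>) ?I"
  have hom: "\<psi> \<in> ring_hom ?R (ATL n)"
    unfolding \<psi>_def by (rule ring_hom_trans[OF I.rcos_ring_hom]) (use assms(2) in \<open>simp add: TL_def\<close>)
  have add: "\<psi> (x + y) = \<psi> x + \<psi> y" if "x \<in> carrier ?R" "y \<in> carrier ?R" for x y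
    using ring_hom_add[OF hom that] by (simp add: free_algebra_def ATL_def)
  have coset: "x - y \<in> ?I \<longleftrightarrow> ?I +>\<^bsub>?R\<^esub> x = ?I +>\<^bsub>?R\<^esub> y" if "x \<in> carrier ?R" "y \<in> carrier ?R" for x y
    using R.quotient_eq_iff_same_a_r_cos[OF ideal_TL_ideal that] free_algebra_a_minus[OF that] by simp
  have zero_in: "0 \<in> carrier ?R" by (simp add: free_algebra_def)
  interpret tl_representation n \<psi>
  proof
    show "\<psi> (free_scalar z_TL) = ATL_scalar n (z_ATL 0)"
      using assms(3) by (simp add: \<psi>_def TL_scalar_def)
    show "\<psi> (free_gen i) = ATL_gen n i" if "i \<in> {1..n-1}" for i
      using assms(4)[OF that] by (simp add: \<psi>_def TL_gen_def)
    \<comment> \<open>\<open>x\<close> and 0 have the same coset, and additivity gives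
      \<open>\<psi> 0 = 0\<close>.\<close>
    show "\<psi> x = 0" if "x \<in> ?I" for x
      using coset[OF TL_ideal_subset[OF that] zero_in] that add[OF zero_in zero_in]
      by (simp add: \<psi>_def)
  qed (rule hom)
  show ?thesis
  proof (rule inj_onI)
    fix X Y assume XY: "X \<in> carrier (TL n)" "Y \<in> carrier (TL n)" and eq: "\<iota> X = \<iota> Y"
    obtain x y where x: "x \<in> carrier ?R" "X = ?I +>\<^bsub>?R\<^esub> x" and y: "y \<in> carrier ?R" "Y = ?I +>\<^bsub>?R\<^esub> y"
      using XY by (auto simp: TL_def FactRing_def A_RCOSETS_def')
    have "\<psi> x = \<psi> (x - y) + \<psi> y"
      using add[OF free_algebra_closed(3)[OF x(1) y(1)] y(1)] by simp
    then have "\<psi> (x - y) = 0" using eq by (simp add: \<psi>_def x y)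
    then have "x - y \<in> ?I" by (rule psi_kernel[OF free_algebra_closed(3)[OF x(1) y(1)]])
    then show "X = Y" using coset x y by simp
  qed
qed

end
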